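(* Let $n\ge 2$ be an integer and $\alpha>0$. Let $(c_j)=(c_1,c_n,c_{n+1},\dots)$ be any non-negative solution, on $t\ge 0$, of the infinite system $$\dot c_1=\alpha-nc_1^n-c_1\sum_{j=n}^{\infty}c_j,\qquad \dot c_n=c_1^n-c_1c_n,\qquad \dot c_j=c_1c_{j-1}-c_1c_j\quad (j\ge n+1),$$ whose initial data satisfy: there exist $\rho_1,\rho_2>0$ and $\mu>1$ such that $j^{\mu}c_j(0)\in[\rho_1,\rho_2]$ for all $j\ge n$. Let $\tau(t):=\int_0^t c_1(s)\,ds$, let $t(\tau)$ be its inverse function, and let $\widetilde c_j(\tau):=c_j(t(\tau))$. Then, as $j,\tau\to+\infty$ with $\eta=j/\tau\neq 1$ fixed ($\eta\in(0,\infty)\setminus\{1\}$), $$\left|\left(\frac{n\tau}{\alpha}\right)^{\frac{n-1}{n}}\widetilde c_j(\tau)-\Phi_1(\eta)\right|\;\sim\;(n-1)\left(1-\frac1n\right)(1-\eta)^{-(n-1)/n}\,\frac{\log((1-\eta)\tau)}{(1-\eta)\tau}\,\mathbf 1_{(0,1)}(\eta)+\left(\frac n\alpha\right)^{(n-1)/n}\mathcal O(1)\,\eta^{-\mu}\,\tau^{\frac{n-1}{n}-\mu}\,\mathbf 1_{(1,\infty)}(\eta),$$ where $\Phi_1(\eta)=(1-\eta)^{-(n-1)/n}$ if $0<\eta<1$ and $\Phi_1(\eta)=0$ if $\eta>1$.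
   Context: The unknowns are the concentrations $c_1(t)$ and $c_j(t)$, $j\ge n$ (there are no components with indices $2,\dots,n-1$). A non-negative solution consists of non-negative functions on $[0,\infty)$ satisfying all the equations, with $\sum_{j\ge n}c_j(t)$ convergent. The function $\tau(t)$ is strictly increasing and tends to $+\infty$ as $t\to+\infty$. $\mathbf 1_S$ is the indicator function of the set $S$; each term on the right-hand side is understood to be $0$ when its indicator vanishes. The symbol $\sim$ means that the ratio of the two sides tends to $1$. $\mathcal O(1)$ denotes a quantity that remains bounded in the limit. The limit is taken, for each fixed $\eta$, along integers $j\to\infty$ with $\tau=j/\eta$. *)

theory Defs
  imports "HOL-Analysis.Analysis" "HOL-Library.Landau_Symbols"
begin

text \<open>
  A family of concentrations is a function \<open>c :: nat \<Rightarrow> real \<Rightarrow> real\<close>, with \<open>c j t\<close> the value of the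
  \<open>j\<close>-th component at time \<open>t\<close>. Only the index \<open>1\<close> and the indices \<open>j \<ge> n\<close> are meaningful; nothing is
  required of \<open>c j\<close> for the other indices, nor of \<open>c j t\<close> for \<open>t < 0\<close>. At \<open>t = 0\<close> the derivatives
  are one-sided.
\<close>

definition nonneg_solution :: "nat \<Rightarrow> real \<Rightarrow> (nat \<Rightarrow> real \<Rightarrow> real) \<Rightarrow> bool" where
  "nonneg_solution n \<alpha> c \<longleftrightarrow>
     (\<forall>t\<ge>0.
        c 1 t \<ge> 0 \<and>
        (\<forall>j\<ge>n. c j t \<ge> 0) \<and>
        summable (\<lambda>k. c (n + k) t) \<and>
        (c 1 has_real_derivative
           \<alpha> - real n * c 1 t ^ n - c 1 t * (\<Sum>k. c (n + k) t)) (at t within {0..}) \<and>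
        (c n has_real_derivative c 1 t ^ n - c 1 t * c n t) (at t within {0..}) \<and>
        (\<forall>j\<ge>n+1. (c j has_real_derivative c 1 t * c (j - 1) t - c 1 t * c j t) (at t within {0..})))"

definition tau :: "(nat \<Rightarrow> real \<Rightarrow> real) \<Rightarrow> real \<Rightarrow> real" where
  "tau c t = integral {0..t} (c 1)"

definition time_of :: "(nat \<Rightarrow> real \<Rightarrow> real) \<Rightarrow> real \<Rightarrow> real" where
  "time_of c = inv_into {0..} (tau c)"

definition ctilde :: "(nat \<Rightarrow> real \<Rightarrow> real) \<Rightarrow> nat \<Rightarrow> real \<Rightarrow> real" where
  "ctilde c j s = c j (time_of c s)"

text \<open>The value at \<open>\<eta> = 1\<close> is immaterial.\<close>

definition Phi1 :: "nat \<Rightarrow> real \<Rightarrow> real" where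
  "Phi1 n \<eta> = (if 0 < \<eta> \<and> \<eta> < 1 then (1 - \<eta>) powr (- (real n - 1) / real n) else 0)"

end

theory Submission
  imports Defs "HOL-Real_Asymp.Real_Asymp"
begin

text \<open>
  In the rescaled time the clusters form a linear chain with unit rates,
  \<open>c\<^sub>j' = c\<^sub>j\<^sub>-\<^sub>1 - c\<^sub>j\<close>, fed at \<open>j = n\<close> with the creation rate \<open>c\<^sub>1 ^ (n - 1)\<close>. A cluster moves one
  index per unit of time on average, so \<open>j = \<tau>\<close> is a front: behind it clusters have been created
  by nucleation, ahead of it they descend from the initial data.

  \<^bold>\<open>Monomers.\<close> The number \<open>N\<close> of clusters satisfies \<open>dN/dt = c\<^sub>1 ^ n\<close>, because no clusters are lost to
  infinity (\<open>clusters_deriv\<close>), and it diverges (\<open>clusters_at_top\<close>). Hence \<open>c\<^sub>1\<close> relaxes at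
  rate \<open>N\<close> to the balance \<open>c\<^sub>1 N = \<alpha> - q\<close>, where the deficit \<open>q\<close> is asymptotic to \<open>n c\<^sub>1 ^ n\<close>,
  the consumption by nucleation; \<open>relaxation_tendsto\<close> makes this rigorous. With
  \<open>d(N ^ n)/d\<tau> = n (\<alpha> - q) ^ (n - 1)\<close>, l'Hopital's rule gives first
  \<open>N ^ n \<sim> n \<alpha> ^ (n - 1) \<tau>\<close>, then \<open>q \<sim> \<alpha> / \<tau>\<close>, and by integrating this deficit
  \<open>N ^ n = n \<alpha> ^ (n - 1) (\<tau> - (n - 1) ln \<tau> + o(ln \<tau>))\<close> (\<open>clusters_log_correction\<close>). So
  the creation rate is \<open>(n \<tau> / \<alpha>) powr (- (n - 1) / n)\<close> times
  \<open>1 + (n - 1) (1 - 1 / n) ln \<tau> / \<tau> + o(ln \<tau> / \<tau>)\<close> (\<open>monomer_excess_asymptotics\<close>).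

  \<^bold>\<open>Chain.\<close> The concentration at index \<open>j\<close> is an average of the creation rate over Gamma
  distributed delays, plus a Poisson mixture of the initial data (\<open>ctilde_representation\<close>). For
  \<open>\<eta> < 1\<close> the delay is concentrated near \<open>j\<close> with variance of order \<open>j\<close>. Hence averaging changes the
  rate at time \<open>\<tau> - j = (1 - \<eta>) \<tau>\<close> by a relative error \<open>O(1 / \<tau>)\<close>, below the logarithmic
  correction (\<open>decaying_input_near_tangent\<close>, \<open>erlang_average_of_decaying_input\<close>), and the initial
  data are exponentially small by a Chernoff bound. For \<open>\<eta> > 1\<close> the roles are exchanged: the
  nucleated part is exponentially small and the tail of the initial data is transported to
  a concentration of order \<open>j powr (- \<mu>)\<close> (\<open>ctilde_ahead_of_front\<close>).
\<close>

section \<open>Barriers and relaxation for scalar differential inequalities\<close>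

lemma upper_barrier:
  fixes f f' :: "real \<Rightarrow> real"
  assumes "a \<le> b" and "f a \<le> M"
    and cont: "continuous_on {a..b} f"
    and der: "\<And>t. a < t \<Longrightarrow> t < b \<Longrightarrow> (f has_real_derivative f' t) (at t)"
    and above: "\<And>t. a < t \<Longrightarrow> t < b \<Longrightarrow> f t > M \<Longrightarrow> f' t \<le> 0"
  shows "f b \<le> M"
proof (rule ccontr)
  assume fb: "\<not> f b \<le> M"
  \<comment> \<open>Follow \<open>f\<close> back from \<open>b\<close> to the last time \<open>s\<close> at which it does not exceed \<open>M\<close>.\<close>
  define S where "S = {a..b} \<inter> f -` {..M}"
  have "closed S"
    unfolding S_def by (rule continuous_closed_preimage[OF cont]) auto
  moreover have "bounded S"
    by (rule bounded_subset[of "{a..b}"]) (auto simp: S_def)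
  ultimately have "compact S"
    by (simp add: compact_eq_bounded_closed)
  moreover have "a \<in> S" using assms(1,2) by (auto simp: S_def)
  ultimately obtain s where s: "s \<in> S" "\<And>t. t \<in> S \<Longrightarrow> t \<le> s"
    using compact_attains_sup by (metis empty_iff)
  have sb: "s < b" "a \<le> s" "f s \<le> M" using s(1) fb by (auto simp: S_def order.order_iff_strict)
  have "continuous_on {s..b} f"
    using cont by (rule continuous_on_subset) (use sb in auto)
  then obtain l z where z: "s < z" "z < b" "(f has_real_derivative l) (at z)" "f b - f s = (b - s) * l"
    using MVT[OF sb(1)] der sb by (metis le_less_trans real_differentiable_def)
  have "f z > M" using s(2)[of z] z(1,2) sb(2) by (force simp: S_def)
  then have "l \<le> 0"
    using above[of z] der[of z] z sb(2) DERIV_unique by fastforce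
  then have "(b - s) * l \<le> 0" using sb(1) by (intro mult_nonneg_nonpos) auto
  then show False using z(4) fb sb(3) by simp
qed

lemma eventually_below_if_decreasing_above:
  fixes f f' :: "real \<Rightarrow> real"
  assumes der: "\<And>t. t \<ge> T \<Longrightarrow> (f has_real_derivative f' t) (at t)"
    and above: "\<And>t. t \<ge> T \<Longrightarrow> f t > M \<Longrightarrow> f' t \<le> -1"
  shows "eventually (\<lambda>t. f t \<le> M) at_top"
proof -
  have cont: "continuous_on {a..b} f" if "a \<ge> T" for a b
    by (intro continuous_at_imp_continuous_on ballI DERIV_isCont[OF der]) (use that in auto)
  have "\<exists>a\<ge>T. f a \<le> M"
  proof (rule ccontr)
    assume "\<not> (\<exists>a\<ge>T. f a \<le> M)"
    then have hi: "f t > M" if "t \<ge> T" for t using that by force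
    define b where "b = T + (f T - M) + 1"
    have b: "b > T" using hi[of T] by (simp add: b_def)
    obtain l z where z: "T < z" "z < b" "(f has_real_derivative l) (at z)" "f b - f T = (b - T) * l"
      using MVT[OF b cont] der by (metis less_eq_real_def order_refl real_differentiable_def)
    have "l \<le> -1"
      using above[of z] hi[of z] der[of z] z DERIV_unique by fastforce
    then have "(b - T) * l \<le> (b - T) * (-1)" using b by (intro mult_left_mono) auto
    then show False using z(4) hi[of b] b by (simp add: b_def)
  qed
  then obtain a where a: "a \<ge> T" "f a \<le> M" by blast
  have "f b \<le> M" if "b \<ge> a" for b
  proof (rule upper_barrier[OF that a(2) cont[OF a(1)], of f'])
    fix t assume "a < t"
    then show "(f has_real_derivative f' t) (at t)" using a(1) by (intro der) auto
    assume "f t > M"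
    then have "f' t \<le> -1" using \<open>a < t\<close> a(1) by (intro above) auto
    then show "f' t \<le> 0" by simp
  qed
  then show ?thesis by (auto simp: eventually_at_top_linorder)
qed

text \<open>
  Once the target \<open>r\<close> is within \<open>\<epsilon> / 4\<close> of \<open>l\<close> and the rate \<open>k\<close> exceeds \<open>4 / \<epsilon>\<close>, a value of \<open>f\<close>
  at distance more than \<open>\<epsilon> / 2\<close> from \<open>l\<close> moves back at speed at least \<open>1\<close>. This replaces a
  study of the flow: quantities that relax ever faster inherit the limit of their
  quasi-stationary value.
\<close>

lemma relaxation_tendsto:
  fixes f k r :: "real \<Rightarrow> real"
  assumes der: "\<forall>\<^sub>F t in at_top. (f has_real_derivative k t * (r t - f t)) (at t)"
    and k: "filterlim k at_top at_top" and r: "(r \<longlongrightarrow> l) at_top"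
  shows "(f \<longlongrightarrow> l) at_top"
proof (rule tendstoI)
  fix e :: real assume e: "e > 0"
  have "\<forall>\<^sub>F t in at_top. k t \<ge> 4 / e" using k by (simp add: filterlim_at_top)
  moreover have "\<forall>\<^sub>F t in at_top. \<bar>r t - l\<bar> < e / 4"
    using tendstoD[OF r, of "e / 4"] e by (simp add: dist_real_def)
  ultimately have "\<forall>\<^sub>F t in at_top. (f has_real_derivative k t * (r t - f t)) (at t) \<and>
      k t \<ge> 4 / e \<and> \<bar>r t - l\<bar> < e / 4"
    using der by eventually_elim auto
  then obtain T where T: "\<And>t. t \<ge> T \<Longrightarrow> (f has_real_derivative k t * (r t - f t)) (at t)"
      "\<And>t. t \<ge> T \<Longrightarrow> k t \<ge> 4 / e" "\<And>t. t \<ge> T \<Longrightarrow> \<bar>r t - l\<bar> < e / 4"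
    by (auto simp: eventually_at_top_linorder)
  have push: "k t * x \<ge> 1" if "t \<ge> T" "x \<ge> e / 4" for t x
  proof -
    have "4 / e > 0" using e by simp
    then have "4 / e * (e / 4) \<le> k t * x"
      using T(2)[OF that(1)] that(2) e by (intro mult_mono) linarith+
    then show ?thesis using e by simp
  qed
  have "\<forall>\<^sub>F t in at_top. f t \<le> l + e / 2"
  proof (rule eventually_below_if_decreasing_above[where T = T, OF T(1)])
    fix t assume t: "t \<ge> T" "f t > l + e / 2"
    show "k t * (r t - f t) \<le> -1"
      using push[OF t(1), of "f t - r t"] T(3)[OF t(1)] t(2) by (simp add: algebra_simps abs_if split: if_splits)
  qed
  moreover have "\<forall>\<^sub>F t in at_top. - f t \<le> - l + e / 2"
  proof (rule eventually_below_if_decreasing_above[where T = T])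
    fix t assume t: "t \<ge> T"
    show "((\<lambda>t. - f t) has_real_derivative - (k t * (r t - f t))) (at t)"
      using T(1)[OF t] by (rule DERIV_minus)
    assume "- f t > - l + e / 2"
    then show "- (k t * (r t - f t)) \<le> -1"
      using push[OF t, of "r t - f t"] T(3)[OF t] by (simp add: abs_if split: if_splits)
  qed
  ultimately show "\<forall>\<^sub>F t in at_top. dist (f t) l < e"
    by eventually_elim (use e in \<open>simp add: dist_real_def abs_if\<close>)
qed

section \<open>Linear chains and the Erlang kernel\<close>

text \<open>
  For fixed \<open>m\<close> this is the Gamma density of shape \<open>m + 1\<close>, the law of the time needed to pass
  \<open>m + 1\<close> stages at unit rate; for fixed \<open>s\<close> it is the Poisson weight of \<open>m\<close> with mean \<open>s\<close>.
\<close>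

definition erlang :: "nat \<Rightarrow> real \<Rightarrow> real" where
  "erlang m s = s ^ m / fact m * exp (- s)"

lemma erlang_nonneg: "s \<ge> 0 \<Longrightarrow> erlang m s \<ge> 0"
  by (simp add: erlang_def)

lemma erlang_at_0: "erlang m 0 = (if m = 0 then 1 else 0)"
  by (simp add: erlang_def)

lemma erlang_deriv:
  "(erlang m has_real_derivative (if m = 0 then 0 else erlang (m - 1) s) - erlang m s) (at s)"
proof -
  have e: "((\<lambda>s. exp (- s)) has_real_derivative - exp (- s)) (at s)"
    by (auto intro!: derivative_eq_intros)
  show ?thesis
  proof (cases m)
    case 0
    then show ?thesis unfolding erlang_def using e by simp
  next
    case (Suc k)
    have p: "((\<lambda>s. s ^ Suc k) has_real_derivative real (Suc k) * s ^ k) (at s)"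
      using DERIV_pow[of "Suc k" s] by simp
    have "real (Suc k) * s ^ k / fact (Suc k) = s ^ k / fact k"
      unfolding fact_Suc of_nat_mult by (rule mult_divide_mult_cancel_left) simp
    then show ?thesis
      unfolding Suc erlang_def
      by (intro DERIV_cong[OF DERIV_mult'[OF DERIV_cdivide[OF p] e]]) (simp del: fact_Suc power_Suc of_nat_Suc)
  qed
qed

lemma continuous_on_erlang: "continuous_on A (erlang m)"
  unfolding erlang_def by (intro continuous_intros) auto

text \<open>
  For fixed \<open>T\<close>, the sum \<open>\<Sum>k \<le> m. erlang (m - k) (T - s) * v k s\<close> equals \<open>v m T\<close> at \<open>s = T\<close>,
  and the adjoint recursion of the kernel cancels all terms of its derivative except
  the input \<open>erlang m (T - s) * u s\<close>. The substitution \<open>s \<mapsto> T - s\<close> gives the form below.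
\<close>

lemma chain_representation:
  fixes v :: "nat \<Rightarrow> real \<Rightarrow> real" and u :: "real \<Rightarrow> real"
  assumes T: "T \<ge> 0"
    and cont: "\<And>k. continuous_on {0..T} (v k)"
    and first: "\<And>s. 0 < s \<Longrightarrow> s < T \<Longrightarrow> (v 0 has_real_derivative u s - v 0 s) (at s)"
    and later: "\<And>k s. 0 < s \<Longrightarrow> s < T \<Longrightarrow> (v (Suc k) has_real_derivative v k s - v (Suc k) s) (at s)"
  shows "((\<lambda>s. erlang m s * u (T - s)) has_integral
    v m T - (\<Sum>k\<le>m. erlang (m - k) T * v k 0)) {0..T}"
proof -
  define W where "W = (\<lambda>s. \<Sum>k\<le>m. erlang (m - k) s * v k (T - s))"
  have ends: "W 0 = v m T" "W T = (\<Sum>k\<le>m. erlang (m - k) T * v k 0)"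
  proof -
    have "W 0 = (\<Sum>k\<le>m. if k = m then v m T else 0)"
      unfolding W_def by (intro sum.cong) (auto simp: erlang_at_0)
    then show "W 0 = v m T" by simp
  qed (simp add: W_def)
  have "((\<lambda>s. - (erlang m s * u (T - s))) has_integral (W T - W 0)) {0..T}"
  proof (rule fundamental_theorem_of_calculus_interior[OF T])
    show "continuous_on {0..T} W"
      unfolding W_def
      by (intro continuous_on_sum continuous_on_mult continuous_on_erlang
          continuous_on_compose2[OF cont]) (auto intro!: continuous_intros)
    fix s assume s: "s \<in> {0<..<T}"
    define in_rate where "in_rate = (\<lambda>k. if k = 0 then u (T - s) else v (k - 1) (T - s))"
    have v': "((\<lambda>s. v k (T - s)) has_real_derivative - (in_rate k - v k (T - s))) (at s)" for k
    proof -
      have "(v k has_real_derivative in_rate k - v k (T - s)) (at (T - s))"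
        using s first[of "T - s"] later[of "T - s" "k - 1"] by (cases k) (auto simp: in_rate_def)
      moreover have "((\<lambda>s. T - s) has_real_derivative - 1) (at s)"
        by (auto intro!: derivative_eq_intros)
      ultimately have "((\<lambda>s. v k (T - s)) has_real_derivative (in_rate k - v k (T - s)) * - 1) (at s)"
        by (rule DERIV_chain2)
      then show ?thesis by simp
    qed
    have "(W has_real_derivative
       (\<Sum>k\<le>m. ((if m - k = 0 then 0 else erlang (m - k - 1) s) - erlang (m - k) s) * v k (T - s)
          + - (in_rate k - v k (T - s)) * erlang (m - k) s)) (at s)"
      unfolding W_def by (intro DERIV_sum DERIV_mult erlang_deriv v')
    also have "(\<Sum>k\<le>m. ((if m - k = 0 then 0 else erlang (m - k - 1) s) - erlang (m - k) s) * v k (T - s)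
          + - (in_rate k - v k (T - s)) * erlang (m - k) s)
      = (\<Sum>k\<le>m. (if m - k = 0 then 0 else erlang (m - k - 1) s) * v k (T - s))
        - (\<Sum>k\<le>m. in_rate k * erlang (m - k) s)"
      unfolding sum_subtractf[symmetric] by (intro sum.cong) (auto simp: algebra_simps)
    also have "(\<Sum>k\<le>m. (if m - k = 0 then 0 else erlang (m - k - 1) s) * v k (T - s))
      = (\<Sum>k<m. erlang (m - Suc k) s * v k (T - s))"
      unfolding lessThan_Suc_atMost[symmetric] sum.lessThan_Suc by (auto intro!: sum.cong)
    also have "(\<Sum>k\<le>m. in_rate k * erlang (m - k) s)
      = u (T - s) * erlang m s + (\<Sum>k<m. v k (T - s) * erlang (m - Suc k) s)"
      unfolding lessThan_Suc_atMost[symmetric] sum.lessThan_Suc_shift by (simp add: in_rate_def)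
    finally have "(W has_real_derivative - (erlang m s * u (T - s))) (at s)"
      by (simp add: mult.commute)
    then show "(W has_vector_derivative - (erlang m s * u (T - s))) (at s)"
      by (simp only: has_real_derivative_iff_has_vector_derivative)
  qed
  from has_integral_neg[OF this] show ?thesis by (simp add: ends)
qed

text \<open>
  Chernoff bounds: multiplying the \<open>k\<close>-th Poisson weight by \<open>r ^ k\<close> turns it into a weight of the
  Poisson law with mean \<open>r s\<close>, up to the factor \<open>exp ((r - 1) s)\<close>.
\<close>

lemma erlang_le_tilted:
  assumes "s \<ge> 0" "r > 0"
  shows "erlang m s \<le> exp ((r - 1) * s) / r ^ m"
proof -
  have "(r * s) ^ m / fact m \<le> exp (r * s)"
  proof -
    have "(\<Sum>k\<in>{m}. (r * s) ^ k /\<^sub>R fact k) \<le> (\<Sum>k. (r * s) ^ k /\<^sub>R fact k)"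
      by (rule sum_le_suminf[OF summable_exp_generic]) (use assms in auto)
    then show ?thesis by (simp add: exp_def divide_inverse mult.commute)
  qed
  then have "(r * s) ^ m / fact m * exp (- s) \<le> exp (r * s) * exp (- s)"
    by (rule mult_right_mono) simp
  also have "\<dots> = exp ((r - 1) * s)" by (simp add: mult_exp_exp algebra_simps)
  finally show ?thesis
    using assms by (simp add: erlang_def power_mult_distrib field_simps)
qed

lemma sum_erlang_tilted_le:
  assumes "s \<ge> 0" "r > 0"
  shows "(\<Sum>k\<le>m. r ^ k * erlang k s) \<le> exp ((r - 1) * s)"
proof -
  have "(\<Sum>k\<le>m. (r * s) ^ k /\<^sub>R fact k) \<le> (\<Sum>k. (r * s) ^ k /\<^sub>R fact k)"
    by (rule sum_le_suminf[OF summable_exp_generic]) (use assms in auto)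
  also have "(\<Sum>k. (r * s) ^ k /\<^sub>R fact k) = exp (r * s)"
    by (simp add: exp_def)
  finally have "(\<Sum>k\<le>m. (r * s) ^ k / fact k) \<le> exp (r * s)"
    by (simp add: divide_inverse mult.commute)
  then have "(\<Sum>k\<le>m. (r * s) ^ k / fact k) * exp (- s) \<le> exp (r * s) * exp (- s)"
    by (rule mult_right_mono) simp
  also have "\<dots> = exp ((r - 1) * s)" by (simp add: mult_exp_exp algebra_simps)
  also have "(\<Sum>k\<le>m. (r * s) ^ k / fact k) * exp (- s) = (\<Sum>k\<le>m. r ^ k * erlang k s)"
    unfolding sum_distrib_right by (intro sum.cong) (auto simp: erlang_def power_mult_distrib)
  finally show ?thesis .
qed

lemma has_integral_erlang_moment:
  "((\<lambda>s. erlang m s * s ^ i) has_integral fact (m + i) / fact m) {0..}"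
proof -
  have "((\<lambda>t. t powr (real (m + i + 1) - 1) / exp t) has_integral Gamma (real (m + i + 1))) {0..}"
    by (rule Gamma_integral_real) simp
  then have "((\<lambda>t. t powr (real (m + i)) / exp t) has_integral fact (m + i)) {0..}"
    using Gamma_fact[of "m + i", where 'a = real] by (simp add: add.commute)
  then have "((\<lambda>t. t powr (real (m + i)) / exp t / fact m) has_integral fact (m + i) / fact m) {0..}"
    by (rule has_integral_divide)
  then show ?thesis
  proof (rule has_integral_spike[where S = "{0}", rotated 2])
    fix t :: real assume "t \<in> {0..} - {0}"
    then show "erlang m t * t ^ i = t powr real (m + i) / exp t / fact m"
      by (simp add: erlang_def powr_realpow power_add exp_minus divide_inverse flip: of_nat_add)
  qed simp
qed

text \<open>
  The fourth moment about a point at bounded distance from the mean \<open>m + 1\<close> is only quadratic in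
  \<open>m\<close>, and the second is linear; this is what makes the errors of the averages below small.
\<close>

lemma erlang_moments_about:
  fixes x :: real
  shows "(erlang m has_integral 1) {0..}"
    and "((\<lambda>s. erlang m s * (x - s)) has_integral (x - real (m + 1))) {0..}"
    and "((\<lambda>s. erlang m s * (x - s) ^ 2) has_integral ((x - real (m + 1))\<^sup>2 + real (m + 1))) {0..}"
    and "((\<lambda>s. erlang m s * (x - s) ^ 4) has_integral
      ((x - real (m + 1)) ^ 4 + 6 * real (m + 1) * (x - real (m + 1))\<^sup>2
        - 8 * real (m + 1) * (x - real (m + 1)) + 3 * (real (m + 1))\<^sup>2 + 6 * real (m + 1))) {0..}"
proof -
  define k where "k = real (m + 1)"
  have facts: "fact (m + 1) / fact m = k" "fact (m + 2) / fact m = k * (k + 1)"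
    "fact (m + 3) / fact m = k * (k + 1) * (k + 2)" "fact (m + 4) / fact m = k * (k + 1) * (k + 2) * (k + 3)"
    by (simp_all add: divide_eq_eq k_def numeral_eq_Suc algebra_simps)
  have M0: "((\<lambda>s. erlang m s) has_integral 1) {0..}"
    using has_integral_erlang_moment[of m 0] by simp
  have M1: "((\<lambda>s. erlang m s * s) has_integral k) {0..}"
    using has_integral_erlang_moment[of m 1] by (simp add: k_def add.commute)
  have M2: "((\<lambda>s. erlang m s * s ^ 2) has_integral k * (k + 1)) {0..}"
    using has_integral_erlang_moment[of m 2] by (simp only: facts)
  have M3: "((\<lambda>s. erlang m s * s ^ 3) has_integral k * (k + 1) * (k + 2)) {0..}"
    using has_integral_erlang_moment[of m 3] by (simp only: facts)
  have M4: "((\<lambda>s. erlang m s * s ^ 4) has_integral k * (k + 1) * (k + 2) * (k + 3)) {0..}"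
    using has_integral_erlang_moment[of m 4] by (simp only: facts)
  show "(erlang m has_integral 1) {0..}" by (rule M0)
  show "((\<lambda>s. erlang m s * (x - s)) has_integral (x - real (m + 1))) {0..}"
    using has_integral_diff[OF has_integral_mult_right[OF M0, of x] M1]
    by (simp add: k_def algebra_simps)
  have "((\<lambda>s. x\<^sup>2 * erlang m s - 2 * x * (erlang m s * s) + erlang m s * s ^ 2) has_integral
      x\<^sup>2 * 1 - 2 * x * k + k * (k + 1)) {0..}"
    by (intro has_integral_add has_integral_diff has_integral_mult_right M0 M1 M2)
  moreover have "x\<^sup>2 * 1 - 2 * x * k + k * (k + 1) = (x - k)\<^sup>2 + k"
    by algebra
  moreover have "(\<lambda>s. x\<^sup>2 * erlang m s - 2 * x * (erlang m s * s) + erlang m s * s ^ 2)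
      = (\<lambda>s. erlang m s * (x - s) ^ 2)"
    by (intro ext) algebra
  ultimately show "((\<lambda>s. erlang m s * (x - s) ^ 2) has_integral ((x - real (m + 1))\<^sup>2 + real (m + 1))) {0..}"
    by (simp add: k_def)
  have "((\<lambda>s. x ^ 4 * erlang m s - 4 * x ^ 3 * (erlang m s * s) + 6 * x\<^sup>2 * (erlang m s * s ^ 2)
        - 4 * x * (erlang m s * s ^ 3) + erlang m s * s ^ 4) has_integral
      x ^ 4 * 1 - 4 * x ^ 3 * k + 6 * x\<^sup>2 * (k * (k + 1)) - 4 * x * (k * (k + 1) * (k + 2))
        + k * (k + 1) * (k + 2) * (k + 3)) {0..}"
    by (intro has_integral_add has_integral_diff has_integral_mult_right M0 M1 M2 M3 M4)
  moreover have "x ^ 4 * 1 - 4 * x ^ 3 * k + 6 * x\<^sup>2 * (k * (k + 1)) - 4 * x * (k * (k + 1) * (k + 2))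
        + k * (k + 1) * (k + 2) * (k + 3)
      = (x - k) ^ 4 + 6 * k * (x - k)\<^sup>2 - 8 * k * (x - k) + 3 * k\<^sup>2 + 6 * k"
    by algebra
  moreover have "(\<lambda>s. x ^ 4 * erlang m s - 4 * x ^ 3 * (erlang m s * s) + 6 * x\<^sup>2 * (erlang m s * s ^ 2)
        - 4 * x * (erlang m s * s ^ 3) + erlang m s * s ^ 4) = (\<lambda>s. erlang m s * (x - s) ^ 4)"
    by (intro ext) algebra
  ultimately show "((\<lambda>s. erlang m s * (x - s) ^ 4) has_integral
      ((x - real (m + 1)) ^ 4 + 6 * real (m + 1) * (x - real (m + 1))\<^sup>2
        - 8 * real (m + 1) * (x - real (m + 1)) + 3 * (real (m + 1))\<^sup>2 + 6 * real (m + 1))) {0..}"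
    by (simp only: k_def)
qed

text \<open>
  The rate in the Chernoff bound: a Poisson variable of mean \<open>T\<close> lies on the far side of \<open>r T\<close>,
  as seen from its mean, with probability at most \<open>exp (- poisson_rate r * T)\<close>.
\<close>

definition poisson_rate :: "real \<Rightarrow> real" where
  "poisson_rate r = 1 - r + r * ln r"

lemma poisson_rate_pos:
  assumes "r > 0" "r \<noteq> 1"
  shows "poisson_rate r > 0"
proof -
  have "ln (1 / r) \<noteq> 1 / r - 1"
    using ln_eq_minus_one[of "1 / r"] assms by auto
  then have "ln (1 / r) < 1 / r - 1"
    using ln_le_minus_one[of "1 / r"] assms by simp
  then have "r * (- ln r) < r * (1 / r - 1)"
    using assms by (intro mult_strict_left_mono) (auto simp: ln_div)
  then show ?thesis using assms by (simp add: poisson_rate_def algebra_simps)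
qed

lemma exp_tilt_div_powr:
  assumes "r > 0"
  shows "exp ((r - 1) * T) / r powr (r * T) = exp (- poisson_rate r * T)"
  using assms by (simp add: powr_def poisson_rate_def algebra_simps flip: exp_diff)

section \<open>Averaging an algebraically decaying input\<close>

text \<open>
  A quadratic error at the tangent lets averages see only the first two moments. The upper
  bound is Young's inequality for \<open>z powr (1 - a)\<close> divided by \<open>z\<close>.
\<close>

lemma powr_minus_ge_tangent:
  fixes a z :: real
  assumes "0 \<le> a" "z > 0"
  shows "1 - a * (z - 1) \<le> z powr (- a)"
proof -
  have "a * ln z \<le> a * (z - 1)"
    using assms by (intro mult_left_mono ln_le_minus_one) auto
  then have "1 - a * (z - 1) \<le> 1 + (- a * ln z)" by simp
  also have "\<dots> \<le> exp (- a * ln z)" by (rule exp_ge_add_one_self)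
  also have "\<dots> = z powr (- a)" using assms by (simp add: powr_def)
  finally show ?thesis .
qed

lemma powr_minus_le_tangent:
  fixes a z :: real
  assumes "0 \<le> a" "a \<le> 1" "z \<ge> 1 / 2"
  shows "z powr (- a) \<le> 1 - a * (z - 1) + 2 * (z - 1)\<^sup>2"
proof -
  define y where "y = z - 1"
  have z: "z = 1 + y" "z > 0" "y \<ge> - 1 / 2" using assms(3) by (auto simp: y_def)
  have "z powr (1 - a) * 1 powr a \<le> (1 - a) * z + a * 1"
    by (rule Youngs_inequality_0) (use assms z in auto)
  then have "z powr (1 - a) \<le> 1 + (1 - a) * y" by (simp add: z algebra_simps)
  also have "\<dots> \<le> (1 - a * y + 2 * y\<^sup>2) * z"
  proof -
    have "(1 - a * y + 2 * y\<^sup>2) * z - (1 + (1 - a) * y) = y\<^sup>2 * (2 - a + 2 * y)"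
      unfolding z(1) by algebra
    also have "\<dots> \<ge> 0" using assms z(3) by (intro mult_nonneg_nonneg) auto
    finally show ?thesis by simp
  qed
  finally have "z powr (1 - a) / z \<le> 1 - a * y + 2 * y\<^sup>2"
    using z(2) by (simp add: divide_le_eq)
  moreover have "z powr (1 - a) / z = z powr (- a)"
    using z(2) by (simp add: powr_diff powr_minus divide_inverse mult.commute)
  ultimately show ?thesis by (simp add: y_def)
qed

text \<open>
  Averaging acts on a window of width \<open>\<delta> L\<close> around \<open>L\<close>, and there the correction
  \<open>h s \<approx> \<kappa> ln s / s\<close> can be frozen at \<open>s = L\<close> to leading order.
\<close>

lemma log_correction_locally_constant:
  fixes h :: "real \<Rightarrow> real" and a \<kappa> \<epsilon> :: real
  assumes h: "((\<lambda>s. h s * (s / ln s)) \<longlongrightarrow> \<kappa>) at_top" and "\<epsilon> > 0"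
  obtains \<delta> L0 where "0 < \<delta>" "\<delta> \<le> 1 / 2" "L0 > exp 1"
    "\<And>L z. L \<ge> L0 \<Longrightarrow> \<bar>z - 1\<bar> \<le> \<delta> \<Longrightarrow> \<bar>z powr (- a) * h (L * z) - \<kappa> * (ln L / L)\<bar> \<le> \<epsilon> * (ln L / L)"
proof -
  \<comment> \<open>Joint limit in the pair \<open>(L, z)\<close>, where \<open>ln (L z) = ln L + ln z\<close> is asymptotic to \<open>ln L\<close>.\<close>
  define F :: "(real \<times> real) filter" where "F = at_top \<times>\<^sub>F nhds 1"
  have L: "filterlim fst at_top F" and z: "(snd \<longlongrightarrow> 1) F"
    unfolding F_def by (rule filterlim_fst, rule filterlim_snd)
  have Lz: "filterlim (\<lambda>p. fst p * snd p) at_top F"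
    by (rule filterlim_at_top_mult_tendsto_pos[OF z _ L]) simp
  have lnL: "filterlim (\<lambda>p. ln (fst p)) at_top F"
    by (rule filterlim_compose[OF ln_at_top L])
  have "((\<lambda>p. snd p powr (- a) * (h (fst p * snd p) * (fst p * snd p / ln (fst p * snd p)))
      * ((1 + ln (snd p) * inverse (ln (fst p))) / snd p)) \<longlongrightarrow>
      1 powr (- a) * \<kappa> * ((1 + ln 1 * 0) / 1)) F"
    by (intro tendsto_intros z filterlim_compose[OF h Lz] tendsto_inverse_0_at_top lnL) auto
  then have "\<forall>\<^sub>F p in F. \<bar>snd p powr (- a) * (h (fst p * snd p) * (fst p * snd p / ln (fst p * snd p)))
      * ((1 + ln (snd p) * inverse (ln (fst p))) / snd p) - \<kappa>\<bar> < \<epsilon>"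
    using tendstoD[OF _ \<open>\<epsilon> > 0\<close>] by (fastforce simp: dist_real_def)
  moreover have "\<forall>\<^sub>F p in F. fst p > exp 1"
    using L by (simp add: filterlim_at_top_dense)
  moreover have "\<forall>\<^sub>F p in F. fst p * snd p > 1"
    using Lz by (simp add: filterlim_at_top_dense)
  moreover have "\<forall>\<^sub>F p in F. snd p > 0"
    using order_tendstoD(1)[OF z, of 0] by simp
  ultimately have "\<forall>\<^sub>F p in F. \<bar>snd p powr (- a) * h (fst p * snd p) - \<kappa> * (ln (fst p) / fst p)\<bar>
      \<le> \<epsilon> * (ln (fst p) / fst p)"
  proof eventually_elim
    case (elim p)
    define L where "L = fst p"
    define z where "z = snd p"
    have L: "L > exp 1" and Lz: "L * z > 1" and z: "z > 0" using elim by (auto simp: L_def z_def)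
    have L0: "L > 0" "L > 1" using L by (meson exp_gt_zero less_trans one_less_exp_iff zero_less_one)+
    then have lnL: "ln L > 0" by simp
    have lnLz: "ln (L * z) > 0" using Lz by simp
    have "1 + ln z * inverse (ln L) = ln (L * z) / ln L"
      using L0 z lnL by (simp add: ln_mult field_simps)
    then have "z powr (- a) * (h (L * z) * (L * z / ln (L * z))) * ((1 + ln z * inverse (ln L)) / z)
        = z powr (- a) * h (L * z) * (L / ln L)"
      using lnLz lnL z by (simp add: field_simps)
    then have "\<bar>z powr (- a) * h (L * z) * (L / ln L) - \<kappa>\<bar> < \<epsilon>"
      using elim(1) by (simp add: L_def z_def)
    then have "\<bar>z powr (- a) * h (L * z) * (L / ln L) - \<kappa>\<bar> * (ln L / L) \<le> \<epsilon> * (ln L / L)"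
      using L0 lnL by (intro mult_right_mono) auto
    also have "\<bar>z powr (- a) * h (L * z) * (L / ln L) - \<kappa>\<bar> * (ln L / L)
        = \<bar>(z powr (- a) * h (L * z) * (L / ln L) - \<kappa>) * (ln L / L)\<bar>"
      using L0 lnL by (simp add: abs_mult)
    also have "(z powr (- a) * h (L * z) * (L / ln L) - \<kappa>) * (ln L / L)
        = z powr (- a) * h (L * z) - \<kappa> * (ln L / L)"
      using L0 lnL by (simp add: field_simps)
    finally show ?case by (simp add: L_def z_def)
  qed
  then obtain P Q where P: "eventually P at_top" and Q: "eventually Q (nhds (1::real))"
    and PQ: "\<And>L z. P L \<Longrightarrow> Q z \<Longrightarrow> \<bar>z powr (- a) * h (L * z) - \<kappa> * (ln L / L)\<bar> \<le> \<epsilon> * (ln L / L)"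
    unfolding F_def eventually_prod_filter by auto
  from P obtain L1 where L1: "\<And>L. L \<ge> L1 \<Longrightarrow> P L" by (auto simp: eventually_at_top_linorder)
  from Q obtain d where d: "d > 0" "\<And>z. dist z 1 < d \<Longrightarrow> Q z" by (auto simp: eventually_nhds_metric)
  show thesis
  proof (rule that[of "min (1 / 2) (d / 2)" "max L1 (exp 1 + 1)"])
    fix L z :: real assume "L \<ge> max L1 (exp 1 + 1)" "\<bar>z - 1\<bar> \<le> min (1 / 2) (d / 2)"
    then show "\<bar>z powr (- a) * h (L * z) - \<kappa> * (ln L / L)\<bar> \<le> \<epsilon> * (ln L / L)"
      using d(1) by (intro PQ L1 d(2)) (auto simp: dist_real_def)
  qed (use d in auto)
qed

text \<open>
  Near \<open>x = L\<close> the input is its tangent up to a quadratic error; away from \<open>L\<close>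
  the crude bound on the input is absorbed by a quartic term, whose average against the
  Erlang kernel is small enough.
\<close>

lemma decaying_input_near_tangent:
  fixes u h :: "real \<Rightarrow> real" and a \<kappa> \<epsilon> B U :: real
  assumes a: "0 \<le> a" "a \<le> 1" and B: "B \<ge> 0"
    and u: "\<And>x. 0 \<le> u x" "\<And>x. u x \<le> U"
    and uh: "\<And>x. x > 0 \<Longrightarrow> B * x powr a * u x = 1 + h x"
    and h: "((\<lambda>s. h s * (s / ln s)) \<longlongrightarrow> \<kappa>) at_top" and \<epsilon>: "\<epsilon> > 0"
  obtains C L0 where "L0 > exp 1" "C \<ge> 0"
    "\<And>L x. L \<ge> L0 \<Longrightarrow> \<bar>B * L powr a * u x - (1 - a * ((x - L) / L) + \<kappa> * (ln L / L))\<bar>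
      \<le> \<epsilon> * (ln L / L) + 2 * ((x - L) / L)\<^sup>2 + C * L * ((x - L) / L) ^ 4"
proof -
  from log_correction_locally_constant[OF h \<epsilon>, of a] obtain \<delta> L0 where \<delta>: "0 < \<delta>" "\<delta> \<le> 1 / 2" and L0: "L0 > exp 1"
    and near: "\<And>L z. L \<ge> L0 \<Longrightarrow> \<bar>z - 1\<bar> \<le> \<delta> \<Longrightarrow>
      \<bar>z powr (- a) * h (L * z) - \<kappa> * (ln L / L)\<bar> \<le> \<epsilon> * (ln L / L)"
    by metis
  have U: "U \<ge> 0" using u order_trans by blast
  define C where "C = (B * U + 1 + \<bar>\<kappa>\<bar>) / \<delta> ^ 4 + 1 / \<delta> ^ 3"
  have C: "C \<ge> 0" using \<delta> B U by (auto simp: C_def)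
  show thesis
  proof (rule that[OF L0 C])
    fix L x :: real assume L: "L \<ge> L0"
    then have L1: "L > exp 1" using L0 by simp
    then have "L > 1" "L > 0" by (meson exp_gt_zero less_trans one_less_exp_iff zero_less_one)+
    then have lnL: "0 < ln L" "ln L \<le> L" using ln_le_minus_one[of L] by auto
    have q: "0 \<le> ln L / L" "ln L / L \<le> 1" using lnL \<open>L > 0\<close> by auto
    define y where "y = (x - L) / L"
    have x: "x = L * (1 + y)" using \<open>L > 0\<close> by (simp add: y_def field_simps)
    have "\<bar>B * L powr a * u x - (1 - a * y + \<kappa> * (ln L / L))\<bar> \<le> \<epsilon> * (ln L / L) + 2 * y\<^sup>2 + C * L * y ^ 4"
    proof (cases "\<bar>y\<bar> \<le> \<delta>")
      case True
      define z where "z = 1 + y"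
      have z: "z \<ge> 1 / 2" using True \<delta> by (auto simp: z_def)
      have "B * x powr a * u x = 1 + h (L * z)"
        using uh[of x] x z \<open>L > 0\<close> by (simp add: z_def)
      moreover have "x powr a = L powr a * z powr a"
        using x z \<open>L > 0\<close> by (simp add: z_def powr_mult)
      ultimately have "B * L powr a * u x * z powr a = 1 + h (L * z)" by (simp add: mult_ac)
      then have "B * L powr a * u x = z powr (- a) * (1 + h (L * z))"
        using z by (simp add: powr_minus field_simps)
      then have "B * L powr a * u x - (1 - a * y + \<kappa> * (ln L / L))
        = (z powr (- a) - (1 - a * (z - 1))) + (z powr (- a) * h (L * z) - \<kappa> * (ln L / L))"
        by (simp add: z_def algebra_simps)
      moreover have "\<bar>z powr (- a) - (1 - a * (z - 1))\<bar> \<le> 2 * (z - 1)\<^sup>2"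
        using powr_minus_ge_tangent[of a z] powr_minus_le_tangent[of a z] a z by (simp add: abs_if)
      moreover have "\<bar>z powr (- a) * h (L * z) - \<kappa> * (ln L / L)\<bar> \<le> \<epsilon> * (ln L / L)"
        using True by (intro near L) (simp add: z_def)
      moreover have "C * L * y ^ 4 \<ge> 0" using C \<open>L > 0\<close> by simp
      ultimately show ?thesis by (simp add: z_def)
    next
      case False
      have y3: "\<delta> ^ 3 \<le> \<bar>y\<bar> ^ 3" and y4: "\<delta> ^ 4 \<le> y ^ 4"
        using False \<delta> power_mono[of \<delta> "\<bar>y\<bar>" 3] power_mono[of \<delta> "\<bar>y\<bar>" 4] by auto
      have "\<bar>y\<bar> * \<delta> ^ 3 \<le> \<bar>y\<bar> * \<bar>y\<bar> ^ 3" using y3 by (intro mult_left_mono) auto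
      also have "\<dots> = y ^ 4" by (simp flip: power_Suc)
      finally have y1: "\<bar>y\<bar> \<le> y ^ 4 / \<delta> ^ 3" using \<delta> by (simp add: pos_le_divide_eq)
      have one: "1 \<le> y ^ 4 / \<delta> ^ 4" using y4 \<delta> by simp
      have "L powr a \<le> L"
        using powr_mono[of a 1 L] a \<open>L > 1\<close> by simp
      then have Bu: "B * L powr a * u x \<le> B * L * U"
        using u B U \<open>L > 0\<close> by (intro mult_mono) auto
      have Bu0: "0 \<le> B * L powr a * u x" using u B by simp
      have "\<bar>1 - a * y + \<kappa> * (ln L / L)\<bar> \<le> 1 + \<bar>a * y\<bar> + \<bar>\<kappa> * (ln L / L)\<bar>" by linarith
      also have "\<bar>a * y\<bar> \<le> \<bar>y\<bar>" using a by (simp add: abs_mult mult_left_le_one_le)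
      also have "\<bar>\<kappa> * (ln L / L)\<bar> = \<bar>\<kappa>\<bar> * (ln L / L)"
        using q(1) by (simp only: abs_mult abs_of_nonneg)
      also have "\<dots> \<le> \<bar>\<kappa>\<bar>" using q(2) by (intro mult_left_le) auto
      finally have "\<bar>B * L powr a * u x - (1 - a * y + \<kappa> * (ln L / L))\<bar> \<le> B * L * U + (1 + \<bar>y\<bar> + \<bar>\<kappa>\<bar>)"
        using Bu Bu0 by linarith
      also have "\<dots> \<le> (B * U + 1 + \<bar>\<kappa>\<bar>) * L + \<bar>y\<bar> * L"
        using mult_left_mono[of 1 L "1 + \<bar>\<kappa>\<bar> + \<bar>y\<bar>"] \<open>L > 1\<close> by (simp add: algebra_simps)
      also have "\<dots> \<le> (B * U + 1 + \<bar>\<kappa>\<bar>) * L * (y ^ 4 / \<delta> ^ 4) + (y ^ 4 / \<delta> ^ 3) * L"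
        using y1 one B U \<open>L > 0\<close> mult_left_mono[OF one, of "(B * U + 1 + \<bar>\<kappa>\<bar>) * L"]
        by (intro add_mono mult_right_mono) auto
      also have "\<dots> = C * L * y ^ 4" by (simp add: C_def algebra_simps)
      finally show ?thesis
        using q \<epsilon> by (smt (verit) mult_nonneg_nonneg zero_le_power2)
    qed
    then show "\<bar>B * L powr a * u x - (1 - a * ((x - L) / L) + \<kappa> * (ln L / L))\<bar>
      \<le> \<epsilon> * (ln L / L) + 2 * ((x - L) / L)\<^sup>2 + C * L * ((x - L) / L) ^ 4"
      by (simp add: y_def)
  qed
qed

lemma has_integral_abs_diff_le:
  fixes f g e :: "real \<Rightarrow> real"
  assumes "(f has_integral I) S" "(g has_integral J) S" "(e has_integral E) S"
    and "\<And>x. x \<in> S \<Longrightarrow> \<bar>f x - g x\<bar> \<le> e x"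
  shows "\<bar>I - J\<bar> \<le> E"
proof -
  have "I - J \<le> E"
    by (rule has_integral_le[OF has_integral_diff[OF assms(1,2)] assms(3)]) (use assms(4) in force)
  moreover have "J - I \<le> E"
    by (rule has_integral_le[OF has_integral_diff[OF assms(2,1)] assms(3)]) (use assms(4) in force)
  ultimately show ?thesis by linarith
qed

text \<open>
  The delay \<open>s\<close> has mean \<open>m + 1 = x - d\<close>, so a bound by powers of \<open>(x - s) / L\<close> integrates to the
  moments of the kernel about \<open>x\<close>. For \<open>L\<close> and \<open>x\<close> of the same order and \<open>d\<close> bounded, the
  quadratic term contributes \<open>1 / L\<close> and a quartic one \<open>C / L ^ 2\<close>.
\<close>

lemma erlang_average_of_decaying_input:
  fixes u :: "real \<Rightarrow> real" and m :: nat and x L T :: real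
  assumes bound: "\<And>s. s \<ge> 0 \<Longrightarrow> \<bar>A * u (T - s) - (1 - a * ((x - s) / L) + b)\<bar>
      \<le> e + 2 * ((x - s) / L)\<^sup>2 + C * ((x - s) / L) ^ 4"
    and u0: "\<And>y. y < 0 \<Longrightarrow> u y = 0"
    and I: "((\<lambda>s. erlang m s * u (T - s)) has_integral I) {0..T}"
    and d: "d = x - real (m + 1)" and k: "k = real (m + 1)"
  shows "\<bar>A * I - (1 - a * d / L + b)\<bar>
      \<le> e + 2 * ((d\<^sup>2 + k) / L\<^sup>2) + C * ((d ^ 4 + 6 * k * d\<^sup>2 - 8 * k * d + 3 * k\<^sup>2 + 6 * k) / L ^ 4)"
proof (rule has_integral_abs_diff_le)
  note M = erlang_moments_about(1)[of m] erlang_moments_about(2-4)[of m x]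
  have "((\<lambda>s. if s \<in> {0..T} then erlang m s * u (T - s) else 0) has_integral I) {0..}"
    using I by (subst has_integral_restrict) auto
  then have "((\<lambda>s. erlang m s * u (T - s)) has_integral I) {0..}"
    by (rule has_integral_eq[rotated]) (auto simp: u0)
  from has_integral_mult_right[OF this, of A]
  show "((\<lambda>s. A * (erlang m s * u (T - s))) has_integral A * I) {0..}" .
  have "((\<lambda>s. (1 + b) * erlang m s - a / L * (erlang m s * (x - s))) has_integral (1 + b) * 1 - a / L * d) {0..}"
    unfolding d by (intro has_integral_diff has_integral_mult_right M)
  then show "((\<lambda>s. (1 + b) * erlang m s - a / L * (erlang m s * (x - s))) has_integral 1 - a * d / L + b) {0..}"
    by (simp add: algebra_simps)
  have "((\<lambda>s. e * erlang m s + 2 / L\<^sup>2 * (erlang m s * (x - s)\<^sup>2) + C / L ^ 4 * (erlang m s * (x - s) ^ 4))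
      has_integral e * 1 + 2 / L\<^sup>2 * (d\<^sup>2 + k) + C / L ^ 4 * (d ^ 4 + 6 * k * d\<^sup>2 - 8 * k * d + 3 * k\<^sup>2 + 6 * k)) {0..}"
    unfolding d k by (intro has_integral_add has_integral_mult_right M)
  then show "((\<lambda>s. e * erlang m s + 2 / L\<^sup>2 * (erlang m s * (x - s)\<^sup>2) + C / L ^ 4 * (erlang m s * (x - s) ^ 4))
      has_integral e + 2 * ((d\<^sup>2 + k) / L\<^sup>2) + C * ((d ^ 4 + 6 * k * d\<^sup>2 - 8 * k * d + 3 * k\<^sup>2 + 6 * k) / L ^ 4)) {0..}"
    by simp
  fix s :: real assume s: "s \<in> {0..}"
  have "\<bar>A * (erlang m s * u (T - s)) - ((1 + b) * erlang m s - a / L * (erlang m s * (x - s)))\<bar>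
      = \<bar>erlang m s * (A * u (T - s) - (1 - a * ((x - s) / L) + b))\<bar>"
    by (simp add: algebra_simps diff_divide_distrib)
  also have "\<dots> = erlang m s * \<bar>A * u (T - s) - (1 - a * ((x - s) / L) + b)\<bar>"
    using erlang_nonneg[of s m] s by (simp add: abs_mult)
  also have "\<dots> \<le> erlang m s * (e + 2 * ((x - s) / L)\<^sup>2 + C * ((x - s) / L) ^ 4)"
    using s by (intro mult_left_mono bound erlang_nonneg) auto
  also have "\<dots> = e * erlang m s + 2 / L\<^sup>2 * (erlang m s * (x - s)\<^sup>2) + C / L ^ 4 * (erlang m s * (x - s) ^ 4)"
    by (simp add: power_divide algebra_simps)
  finally show "\<bar>A * (erlang m s * u (T - s)) - ((1 + b) * erlang m s - a / L * (erlang m s * (x - s)))\<bar>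
    \<le> e * erlang m s + 2 / L\<^sup>2 * (erlang m s * (x - s)\<^sup>2) + C / L ^ 4 * (erlang m s * (x - s) ^ 4)" .
qed

section \<open>The solution in physical time\<close>

locale nucleation_chain =
  fixes n :: nat and \<alpha> :: real and c :: "nat \<Rightarrow> real \<Rightarrow> real"
  assumes n_ge_2: "n \<ge> 2" and \<alpha>_pos: "\<alpha> > 0" and solution: "nonneg_solution n \<alpha> c"
begin

definition clusters :: "real \<Rightarrow> real" where
  "clusters t = (\<Sum>k. c (n + k) t)"

lemma nonneg: "t \<ge> 0 \<Longrightarrow> c 1 t \<ge> 0" "t \<ge> 0 \<Longrightarrow> j \<ge> n \<Longrightarrow> c j t \<ge> 0"
  using solution by (auto simp: nonneg_solution_def)

lemma summable_clusters: "t \<ge> 0 \<Longrightarrow> summable (\<lambda>k. c (n + k) t)"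
  using solution by (auto simp: nonneg_solution_def)

lemma ode_within:
  assumes "t \<ge> 0"
  shows "(c 1 has_real_derivative \<alpha> - real n * c 1 t ^ n - c 1 t * clusters t) (at t within {0..})"
    and "(c n has_real_derivative c 1 t ^ n - c 1 t * c n t) (at t within {0..})"
    and "j > n \<Longrightarrow> (c j has_real_derivative c 1 t * c (j - 1) t - c 1 t * c j t) (at t within {0..})"
  using solution assms by (auto simp: nonneg_solution_def clusters_def)

lemma ode:
  assumes "t > 0"
  shows "(c 1 has_real_derivative \<alpha> - real n * c 1 t ^ n - c 1 t * clusters t) (at t)"
    and "(c n has_real_derivative c 1 t ^ n - c 1 t * c n t) (at t)"
    and "j > n \<Longrightarrow> (c j has_real_derivative c 1 t * c (j - 1) t - c 1 t * c j t) (at t)"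
proof -
  have "at t within {0..} = at t"
    using assms by (intro at_within_interior) auto
  then show "(c 1 has_real_derivative \<alpha> - real n * c 1 t ^ n - c 1 t * clusters t) (at t)"
    "(c n has_real_derivative c 1 t ^ n - c 1 t * c n t) (at t)"
    "j > n \<Longrightarrow> (c j has_real_derivative c 1 t * c (j - 1) t - c 1 t * c j t) (at t)"
    using ode_within[of t] assms by auto
qed

lemma continuous_on_c: "continuous_on {0..} (c 1)" "j \<ge> n \<Longrightarrow> continuous_on {0..} (c j)"
proof -
  show "continuous_on {0..} (c 1)"
    using ode_within(1) by (intro DERIV_continuous_on) auto
  show "continuous_on {0..} (c j)" if "j \<ge> n"
  proof (cases "j = n")
    case True
    then show ?thesis using ode_within(2) by (intro DERIV_continuous_on) auto
  next
    case False
    then have "j > n" using that by simp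
    from ode_within(3)[OF _ this] show ?thesis by (intro DERIV_continuous_on) auto
  qed
qed

lemma clusters_nonneg: "t \<ge> 0 \<Longrightarrow> clusters t \<ge> 0"
  unfolding clusters_def by (intro suminf_nonneg summable_clusters nonneg) auto

definition monomer_bound :: real where
  "monomer_bound = max (c 1 0) (max 1 \<alpha>)"

lemma monomer_bound_ge_1: "monomer_bound \<ge> 1"
  by (simp add: monomer_bound_def)

text \<open>Above \<open>max 1 \<alpha>\<close> the sink \<open>n c\<^sub>1 ^ n\<close> outweighs the source \<open>\<alpha>\<close>.\<close>

lemma monomers_le:
  assumes "t \<ge> 0"
  shows "c 1 t \<le> monomer_bound"
proof (rule upper_barrier[OF assms])
  show "c 1 0 \<le> monomer_bound" by (simp add: monomer_bound_def)
  show "continuous_on {0..t} (c 1)"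
    using continuous_on_c(1) by (rule continuous_on_subset) auto
next
  fix s :: real assume "0 < s"
  then show "(c 1 has_real_derivative \<alpha> - real n * c 1 s ^ n - c 1 s * clusters s) (at s)"
    by (rule ode)
next
  fix s :: real assume s: "0 < s" "c 1 s > monomer_bound"
  have c: "c 1 s > 1" "c 1 s > \<alpha>" using s(2) by (auto simp: monomer_bound_def)
  have "\<alpha> \<le> c 1 s ^ n"
    using c n_ge_2 self_le_power[of "c 1 s" n] by linarith
  also have "\<dots> \<le> real n * c 1 s ^ n"
    using n_ge_2 c mult_right_mono[of 1 "real n" "c 1 s ^ n"] by simp
  finally show "\<alpha> - real n * c 1 s ^ n - c 1 s * clusters s \<le> 0"
    using mult_nonneg_nonneg[of "c 1 s" "clusters s"] c clusters_nonneg[of s] s by linarith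
qed

text \<open>At a zero of \<open>c 1\<close> its derivative is \<open>\<alpha> > 0\<close>, so just before it would be negative.\<close>

lemma monomers_pos:
  assumes "t > 0"
  shows "c 1 t > 0"
proof (rule ccontr)
  assume "\<not> c 1 t > 0"
  then have "c 1 t = 0" using nonneg(1)[of t] assms by simp
  then have "(c 1 has_real_derivative \<alpha>) (at t)"
    using ode(1)[OF assms] n_ge_2 by (simp add: power_0_left)
  then obtain d where d: "d > 0" "\<And>h. 0 < h \<Longrightarrow> h < d \<Longrightarrow> c 1 (t - h) < c 1 t"
    using DERIV_pos_inc_left[of "c 1" \<alpha> t] \<alpha>_pos by blast
  have "c 1 (t - min (d / 2) (t / 2)) < c 1 t"
    by (rule d(2)) (use d(1) assms in \<open>auto simp: min_def\<close>)
  moreover have "c 1 (t - min (d / 2) (t / 2)) \<ge> 0"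
    by (rule nonneg) (use assms in \<open>auto simp: min_def\<close>)
  ultimately show False using \<open>c 1 t = 0\<close> by simp
qed

text \<open>
  Summing the chain telescopes: the first \<open>m + 1\<close> clusters grow at rate
  \<open>c\<^sub>1 ^ n - c\<^sub>1 c\<^sub>n\<^sub>+\<^sub>m\<close>. The flux out of the top tends to \<open>0\<close> pointwise and is dominated,
  so no clusters are lost to infinity.
\<close>

lemma clusters_integral:
  assumes "t \<ge> 0"
  shows "((\<lambda>s. c 1 s ^ n) has_integral (clusters t - clusters 0)) {0..t}"
proof -
  define S where "S = (\<lambda>m t. \<Sum>k\<le>m. c (n + k) t)"
  have S_deriv: "(S m has_real_derivative c 1 s ^ n - c 1 s * c (n + m) s) (at s within {0..})"
    if "s \<ge> 0" for s m
  proof (induction m)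
    case 0
    then show ?case using ode_within(2)[OF that] by (simp add: S_def)
  next
    case (Suc m)
    have "((\<lambda>t. S m t + c (n + Suc m) t) has_real_derivative
       (c 1 s ^ n - c 1 s * c (n + m) s) + (c 1 s * c (n + Suc m - 1) s - c 1 s * c (n + Suc m) s))
       (at s within {0..})"
      by (intro DERIV_add Suc ode_within) (use that in auto)
    then show ?case by (simp add: S_def)
  qed
  have S_le_clusters: "S m s \<le> clusters s" if "s \<ge> 0" for m s
    unfolding S_def clusters_def using sum_le_suminf[OF summable_clusters[OF that], of "{..m}"] nonneg(2)[OF that] by auto
  have S_int: "((\<lambda>s. c 1 s ^ n - c 1 s * c (n + m) s) has_integral (S m x - S m 0)) {0..x}"
    if "x \<ge> 0" for m x
  proof (rule fundamental_theorem_of_calculus[OF that])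
    fix s assume "s \<in> {0..x}"
    then have "(S m has_real_derivative c 1 s ^ n - c 1 s * c (n + m) s) (at s within {0..x})"
      by (intro DERIV_subset[OF S_deriv]) auto
    then show "(S m has_vector_derivative c 1 s ^ n - c 1 s * c (n + m) s) (at s within {0..x})"
      by (simp only: has_real_derivative_iff_has_vector_derivative)
  qed
  have cn_int: "(\<lambda>s. c 1 s ^ n) integrable_on {0..x}" for x
    by (intro integrable_continuous_interval continuous_on_power continuous_on_subset[OF continuous_on_c(1)]) auto
  define B where "B = clusters 0 + t * monomer_bound ^ n"
  have S_le: "S m x \<le> B" if "0 \<le> x" "x \<le> t" for m x
  proof -
    have "S m x - S m 0 \<le> integral {0..x} (\<lambda>s. monomer_bound ^ n)"
      unfolding integral_unique[OF S_int[OF that(1)], symmetric]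
    proof (rule integral_le)
      fix s assume s: "s \<in> {0..x}"
      have "c 1 s ^ n \<le> monomer_bound ^ n"
        using s by (intro power_mono monomers_le nonneg) auto
      then show "c 1 s ^ n - c 1 s * c (n + m) s \<le> monomer_bound ^ n"
        using s nonneg by (smt (verit) atLeastAtMost_iff le_add1 mult_nonneg_nonneg)
    qed (use S_int[OF that(1)] in auto)
    also have "\<dots> \<le> t * monomer_bound ^ n"
      using that monomer_bound_ge_1 by (simp add: mult_right_mono)
    finally show ?thesis using S_le_clusters[of 0 m] by (simp add: B_def)
  qed
  have flux: "(\<lambda>m. integral {0..t} (\<lambda>s. c 1 s * c (n + m) s)) \<longlonglongrightarrow> integral {0..t} (\<lambda>s. 0)"
  proof (rule dominated_convergence(2))
    show "(\<lambda>s. c 1 s * c (n + m) s) integrable_on {0..t}" for m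
      by (intro integrable_continuous_interval continuous_on_mult continuous_on_subset[OF continuous_on_c(1)]
          continuous_on_subset[OF continuous_on_c(2)]) auto
    show "(\<lambda>s. monomer_bound * B) integrable_on {0..t}"
      by (intro integrable_continuous_interval continuous_on_const)
    fix s assume s: "s \<in> {0..t}"
    show "norm (c 1 s * c (n + m) s) \<le> monomer_bound * B" for m
    proof -
      have "c (n + m) s \<le> S m s"
        unfolding S_def using s nonneg(2)[of s] by (intro member_le_sum[of m "{..m}" "\<lambda>k. c (n + k) s"]) auto
      also have "\<dots> \<le> B" using S_le s by simp
      finally have "c 1 s * c (n + m) s \<le> monomer_bound * B"
        using s monomer_bound_ge_1 by (intro mult_mono monomers_le nonneg) auto
      moreover have "c 1 s * c (n + m) s \<ge> 0"
        using s by (intro mult_nonneg_nonneg nonneg) auto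
      ultimately show ?thesis by simp
    qed
    show "(\<lambda>m. c 1 s * c (n + m) s) \<longlonglongrightarrow> 0"
      using s by (intro tendsto_mult_right_zero summable_LIMSEQ_zero summable_clusters) auto
  qed
  have "(\<lambda>m. integral {0..t} (\<lambda>s. c 1 s ^ n) - integral {0..t} (\<lambda>s. c 1 s * c (n + m) s))
      \<longlonglongrightarrow> integral {0..t} (\<lambda>s. c 1 s ^ n) - 0"
    using flux by (intro tendsto_diff tendsto_const) simp
  moreover have "integral {0..t} (\<lambda>s. c 1 s ^ n) - integral {0..t} (\<lambda>s. c 1 s * c (n + m) s) = S m t - S m 0" for m
  proof -
    have "(\<lambda>s. c 1 s * c (n + m) s) integrable_on {0..t}"
      by (intro integrable_continuous_interval continuous_on_mult continuous_on_subset[OF continuous_on_c(1)]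
          continuous_on_subset[OF continuous_on_c(2)]) auto
    from integral_diff[OF cn_int this] show ?thesis
      using integral_unique[OF S_int[OF assms, of m]] by simp
  qed
  moreover have "(\<lambda>m. S m t - S m 0) \<longlonglongrightarrow> clusters t - clusters 0"
    unfolding S_def clusters_def
    by (intro tendsto_diff summable_LIMSEQ' summable_clusters assms order_refl)
  ultimately have "integral {0..t} (\<lambda>s. c 1 s ^ n) = clusters t - clusters 0"
    by (simp add: LIMSEQ_unique)
  then show ?thesis using integrable_integral[OF cn_int, of t] by simp
qed

lemma clusters_deriv:
  assumes "t > 0"
  shows "(clusters has_real_derivative c 1 t ^ n) (at t)"
proof -
  have int: "at t within {0..t+1} = at t"
    using assms by (intro at_within_interior) auto
  have "continuous_on {0..t+1} (\<lambda>s. c 1 s ^ n)"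
    by (intro continuous_on_power continuous_on_subset[OF continuous_on_c(1)]) auto
  from integral_has_real_derivative[OF this, of t] assms
  have "((\<lambda>t. integral {0..t} (\<lambda>s. c 1 s ^ n)) has_real_derivative c 1 t ^ n) (at t)"
    by (simp add: int)
  then have "((\<lambda>t. integral {0..t} (\<lambda>s. c 1 s ^ n) + clusters 0) has_real_derivative c 1 t ^ n) (at t)"
    by (auto intro: derivative_eq_intros)
  then show ?thesis
  proof (rule has_field_derivative_transform_within_open[where S = "{0<..}"])
    fix x :: real assume "x \<in> {0<..}"
    then show "integral {0..x} (\<lambda>s. c 1 s ^ n) + clusters 0 = clusters x"
      using integral_unique[OF clusters_integral[of x]] by simp
  qed (use assms in auto)
qed

lemma clusters_mono:
  assumes "0 < s" "s \<le> t"
  shows "clusters s \<le> clusters t"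
proof (rule DERIV_nonneg_imp_nondecreasing[OF assms(2)])
  fix x assume "s \<le> x"
  then have "x > 0" using assms(1) by simp
  then show "\<exists>y. (clusters has_real_derivative y) (at x) \<and> 0 \<le> y"
    using clusters_deriv nonneg(1)[of x] by (intro exI[of _ "c 1 x ^ n"]) auto
qed

text \<open>
  If the number of clusters stayed below \<open>B\<close>, monomers would be consumed by growth at rate
  at most \<open>B c\<^sub>1 \<le> \<alpha>/2 + D c\<^sub>1 ^ n\<close>; hence \<open>c\<^sub>1 + (n + D) clusters\<close> would grow at rate at
  least \<open>\<alpha>/2\<close> for ever, although both of its terms are bounded.
\<close>

lemma clusters_at_top: "filterlim clusters at_top at_top"
proof -
  have unbounded: "\<exists>t>0. clusters t > B" for B
  proof (rule ccontr)
    assume "\<not> (\<exists>t>0. clusters t > B)"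
    then have le: "clusters t \<le> max B 1" if "t > 0" for t using that by force
    define B' where "B' = max B 1"
    have B': "B' > 0" "\<And>t. t > 0 \<Longrightarrow> clusters t \<le> B'" using le by (auto simp: B'_def)
    define e where "e = \<alpha> / (2 * B')"
    define D where "D = B' / e ^ (n - 1)"
    have e: "e > 0" "B' * e = \<alpha> / 2" using \<alpha>_pos B' by (auto simp: e_def)
    have D: "D > 0" using B' e by (simp add: D_def)
    have split: "B' * x \<le> \<alpha> / 2 + D * x ^ n" if "x \<ge> 0" for x
    proof (cases "x \<le> e")
      case True
      then have "B' * x \<le> \<alpha> / 2" using B'(1) by (simp flip: e(2))
      moreover have "D * x ^ n \<ge> 0" using D that by simp
      ultimately show ?thesis by linarith
    next
      case False
      have "B' * x * e ^ (n - 1) \<le> B' * x * x ^ (n - 1)"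
        using False e that B' by (intro mult_left_mono power_mono) auto
      also have "\<dots> = B' * x ^ n" using n_ge_2 by (simp add: power_eq_if)
      finally have "B' * x \<le> D * x ^ n" using e by (simp add: D_def field_simps)
      then show ?thesis using \<alpha>_pos by simp
    qed
    define f where "f = (\<lambda>t. c 1 t + (n + D) * clusters t - \<alpha> / 2 * t)"
    have f_deriv: "(f has_real_derivative
        (\<alpha> - real n * c 1 t ^ n - c 1 t * clusters t) + (n + D) * (c 1 t ^ n) - \<alpha> / 2) (at t)"
      if "t > 0" for t
      unfolding f_def
      by (intro DERIV_add DERIV_diff DERIV_cmult ode clusters_deriv that) (auto intro!: derivative_eq_intros)
    have f_inc: "f 1 \<le> f t" if "t \<ge> 1" for t
    proof (rule DERIV_nonneg_imp_nondecreasing[OF that])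
      fix s :: real assume s: "1 \<le> s"
      have "c 1 s * clusters s \<le> B' * c 1 s"
        using B'(2)[of s] monomers_pos[of s] s by simp
      also have "\<dots> \<le> \<alpha> / 2 + D * c 1 s ^ n"
        using split nonneg s by simp
      finally have "0 \<le> (\<alpha> - real n * c 1 s ^ n - c 1 s * clusters s) + (n + D) * (c 1 s ^ n) - \<alpha> / 2"
        by (simp add: algebra_simps)
      then show "\<exists>y. (f has_real_derivative y) (at s) \<and> 0 \<le> y"
        using f_deriv[of s] s by auto
    qed
    define t where "t = max 1 ((monomer_bound + (n + D) * B' - f 1 + 1) / (\<alpha> / 2))"
    have t: "t \<ge> 1" "\<alpha> / 2 * t \<ge> monomer_bound + (n + D) * B' - f 1 + 1"
      using \<alpha>_pos by (auto simp: t_def max_def field_simps)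
    have "(n + D) * clusters t \<le> (n + D) * B'"
      using B'(2)[of t] t D by (intro mult_left_mono) auto
    then have "f t \<le> monomer_bound + (n + D) * B' - \<alpha> / 2 * t"
      using monomers_le[of t] t(1) by (simp add: f_def)
    then show False using f_inc[OF t(1)] t(2) by linarith
  qed
  show ?thesis
    unfolding filterlim_at_top
  proof
    fix B
    obtain t where "t > 0" "clusters t > B" using unbounded by blast
    then have "B \<le> clusters s" if "s \<ge> t" for s
      using clusters_mono[of t s] that by simp
    then show "\<forall>\<^sub>F s in at_top. B \<le> clusters s"
      by (auto simp: eventually_at_top_linorder)
  qed
qed

text \<open>Keeps the simplifier from rewriting the component \<open>c 1\<close> to \<open>c (Suc 0)\<close>.\<close>

declare One_nat_def [simp del]

section \<open>The rescaled time\<close>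

lemma tau_0 [simp]: "tau c 0 = 0"
  by (simp add: tau_def)

lemma integrable_monomers: "c 1 integrable_on {0..t}"
  by (intro integrable_continuous_interval continuous_on_subset[OF continuous_on_c(1)]) auto

lemma continuous_on_tau: "continuous_on {0..} (tau c)"
proof -
  have cont: "continuous_on {0..b} (tau c)" for b
    unfolding tau_def using indefinite_integral_continuous_1[OF integrable_monomers] by blast
  show ?thesis
    unfolding continuous_on_eq_continuous_within
  proof
    fix x :: real assume x: "x \<in> {0..}"
    have "at x within {0..} = at x within {0..x + 1}"
      by (rule at_within_nhd[of _ "{..<x + 1}"]) (auto simp: set_eq_iff)
    then show "continuous (at x within {0..}) (tau c)"
      using cont[of "x + 1"] x by (simp add: continuous_on_eq_continuous_within)
  qed
qed

lemma tau_deriv: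
  assumes "t > 0"
  shows "(tau c has_real_derivative c 1 t) (at t)"
proof -
  have int: "at t within {0..t+1} = at t"
    using assms by (intro at_within_interior) auto
  have "continuous_on {0..t+1} (c 1)"
    by (intro continuous_on_subset[OF continuous_on_c(1)]) auto
  from integral_has_real_derivative[OF this, of t] assms
  show ?thesis unfolding tau_def by (simp add: int)
qed

lemma tau_strict_mono:
  assumes "0 \<le> s" "s < t"
  shows "tau c s < tau c t"
proof -
  have "continuous_on {s..t} (tau c)"
    using assms by (intro continuous_on_subset[OF continuous_on_tau]) auto
  then obtain l z where z: "s < z" "(tau c has_real_derivative l) (at z)" "tau c t - tau c s = (t - s) * l"
    using MVT[OF assms(2)] tau_deriv assms(1) by (metis le_less_trans real_differentiable_def)
  then have "l > 0"
    using monomers_pos[of z] tau_deriv[of z] DERIV_unique assms(1) by fastforce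
  then have "(t - s) * l > 0" using assms(2) by simp
  then show ?thesis using z(3) by simp
qed

lemma tau_nonneg: "t \<ge> 0 \<Longrightarrow> tau c t \<ge> 0"
  using tau_strict_mono[of 0 t] by (cases "t = 0") auto

text \<open>
  Clusters are created at rate \<open>c 1 ^ n \<le> monomer_bound ^ (n - 1) * c 1\<close>, so the divergence of
  their number forces the divergence of \<open>tau c\<close>.
\<close>

lemma tau_at_top: "filterlim (tau c) at_top at_top"
proof -
  have le: "clusters t - clusters 0 \<le> monomer_bound ^ (n - 1) * tau c t" if "t \<ge> 0" for t
  proof -
    have "clusters t - clusters 0 = integral {0..t} (\<lambda>s. c 1 s ^ n)"
      using clusters_integral[OF that] by (simp add: integral_unique)
    also have "\<dots> \<le> integral {0..t} (\<lambda>s. monomer_bound ^ (n - 1) * c 1 s)"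
    proof (rule integral_le)
      show "(\<lambda>s. c 1 s ^ n) integrable_on {0..t}"
        using clusters_integral[OF that] by blast
      show "(\<lambda>s. monomer_bound ^ (n - 1) * c 1 s) integrable_on {0..t}"
        by (intro integrable_on_mult_right integrable_monomers)
      fix s assume s: "s \<in> {0..t}"
      have "c 1 s ^ (n - 1) * c 1 s \<le> monomer_bound ^ (n - 1) * c 1 s"
        using s by (intro mult_right_mono power_mono monomers_le nonneg) auto
      then show "c 1 s ^ n \<le> monomer_bound ^ (n - 1) * c 1 s"
        using n_ge_2 by (simp add: power_eq_if mult.commute)
    qed
    also have "\<dots> = monomer_bound ^ (n - 1) * tau c t"
      by (simp add: tau_def)
    finally show ?thesis .
  qed
  have pos: "monomer_bound ^ (n - 1) > 0" using monomer_bound_ge_1 by simp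
  have "filterlim (\<lambda>t. (- clusters 0 + clusters t) * inverse (monomer_bound ^ (n - 1))) at_top at_top"
    using pos by (intro filterlim_at_top_mult_tendsto_pos[OF tendsto_const] filterlim_tendsto_add_at_top[OF tendsto_const] clusters_at_top) auto
  moreover have "\<forall>\<^sub>F t in at_top. (- clusters 0 + clusters t) * inverse (monomer_bound ^ (n - 1)) \<le> tau c t"
    using eventually_ge_at_top[of 0] by eventually_elim (use le pos in \<open>simp add: field_simps\<close>)
  ultimately show ?thesis by (rule filterlim_at_top_mono)
qed

lemma inj_on_tau: "inj_on (tau c) {0..}"
proof (rule linorder_inj_onI')
  fix s t :: real assume "s \<in> {0..}" "s < t"
  then show "tau c s \<noteq> tau c t" using tau_strict_mono[of s t] by simp
qed

lemma time_of_tau: "t \<ge> 0 \<Longrightarrow> time_of c (tau c t) = t"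
  unfolding time_of_def by (rule inv_into_f_f[OF inj_on_tau]) auto

lemma tau_time_of:
  assumes "s \<ge> 0"
  shows "time_of c s \<ge> 0" "tau c (time_of c s) = s"
proof -
  obtain t where t: "t \<ge> 0" "tau c t \<ge> s"
    using eventually_conj[OF eventually_ge_at_top[of 0] tau_at_top[unfolded filterlim_at_top, THEN spec, of s]]
    by (auto simp: eventually_at_top_linorder)
  have "\<exists>x\<ge>0. x \<le> t \<and> tau c x = s"
    using t assms by (intro IVT' continuous_on_subset[OF continuous_on_tau]) auto
  then have "s \<in> tau c ` {0..}" by auto
  then show "time_of c s \<ge> 0" "tau c (time_of c s) = s"
    unfolding time_of_def using inv_into_into[of s "tau c" "{0..}"] by (auto simp: f_inv_into_f simp del: inv_into_f_f)
qed

lemma time_of_0 [simp]: "time_of c 0 = 0"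
  using time_of_tau[of 0] by simp

lemma time_of_strict_mono:
  assumes "0 \<le> s" "s < t"
  shows "time_of c s < time_of c t"
proof (rule ccontr)
  assume "\<not> time_of c s < time_of c t"
  then have "time_of c t = time_of c s \<or> time_of c t < time_of c s" by linarith
  then have "tau c (time_of c t) \<le> tau c (time_of c s)"
    using tau_strict_mono[of "time_of c t" "time_of c s"] tau_time_of(1)[of t] assms by auto
  then show False using tau_time_of(2)[of s] tau_time_of(2)[of t] assms by simp
qed

lemma time_of_at_top: "filterlim (time_of c) at_top at_top"
  unfolding filterlim_at_top
proof
  fix B :: real
  define b :: real where "b = max B 0"
  have "time_of c s \<ge> B" if "s > tau c b" for s
    using time_of_strict_mono[of "tau c b" s] time_of_tau[of b] tau_nonneg[of b] that
    by (simp add: b_def)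
  then show "\<forall>\<^sub>F s in at_top. B \<le> time_of c s"
    unfolding eventually_at_top_dense by blast
qed

section \<open>Asymptotics of monomers and clusters\<close>

text \<open>
  The part of the source \<open>\<alpha>\<close> that is not spent on the growth of clusters. To leading order
  it is the consumption \<open>n c\<^sub>1 ^ n\<close> by nucleation, which is proved in three relaxation steps:
  \<open>c 1\<close>, \<open>deficit\<close> and \<open>deficit / c 1 ^ n\<close> follow quasi-stationary values with limits
  \<open>0\<close>, \<open>0\<close> and \<open>n\<close>, at rates \<open>clusters\<close>, \<open>clusters\<close> and about \<open>\<alpha> / c 1\<close>, which tend to infinity.
\<close>

definition deficit :: "real \<Rightarrow> real" where
  "deficit t = \<alpha> - c 1 t * clusters t"

lemma monomers_tendsto_0: "(c 1 \<longlongrightarrow> 0) at_top"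
proof (rule relaxation_tendsto[OF _ clusters_at_top])
  show "\<forall>\<^sub>F t in at_top. (c 1 has_real_derivative
      clusters t * ((\<alpha> - real n * c 1 t ^ n) / clusters t - c 1 t)) (at t)"
    using eventually_gt_at_top[of 0] clusters_at_top[unfolded filterlim_at_top_dense, THEN spec, of 0]
    by eventually_elim (rule DERIV_cong[OF ode(1)], auto simp: field_simps)
  have "eventually (\<lambda>t. norm (\<alpha> - real n * c 1 t ^ n) \<le> \<alpha> + real n * monomer_bound ^ n) at_top"
    using eventually_ge_at_top[of 0]
  proof eventually_elim
    case (elim t)
    then have "c 1 t ^ n \<le> monomer_bound ^ n" "c 1 t ^ n \<ge> 0"
      using monomers_le nonneg by (auto intro: power_mono)
    then have "real n * c 1 t ^ n \<le> real n * monomer_bound ^ n" "real n * c 1 t ^ n \<ge> 0"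
      by (auto intro: mult_left_mono)
    then show ?case using \<alpha>_pos by (simp add: abs_if)
  qed
  then have "\<forall>\<^sub>F t in at_top. norm ((\<alpha> - real n * c 1 t ^ n) / clusters t)
      \<le> norm (inverse (clusters t)) * (\<alpha> + real n * monomer_bound ^ n)"
    by eventually_elim (simp add: divide_inverse abs_mult mult.commute mult_left_mono)
  then show "((\<lambda>t. (\<alpha> - real n * c 1 t ^ n) / clusters t) \<longlongrightarrow> 0) at_top"
    by (rule tendsto_0_le[OF tendsto_inverse_0_at_top[OF clusters_at_top]])
qed

lemma deficit_deriv:
  assumes "t > 0"
  shows "(deficit has_real_derivative
    - ((deficit t - real n * c 1 t ^ n) * clusters t + c 1 t ^ Suc n)) (at t)"
proof -
  have "(deficit has_real_derivative
     0 - (c 1 t * c 1 t ^ n + (\<alpha> - real n * c 1 t ^ n - c 1 t * clusters t) * clusters t)) (at t)"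
    unfolding deficit_def by (intro DERIV_diff DERIV_const DERIV_mult' ode clusters_deriv assms)
  then show ?thesis
    by (rule DERIV_cong) (simp add: deficit_def algebra_simps)
qed

lemma deficit_tendsto_0: "(deficit \<longlongrightarrow> 0) at_top"
proof (rule relaxation_tendsto[OF _ clusters_at_top])
  show "\<forall>\<^sub>F t in at_top. (deficit has_real_derivative
      clusters t * (real n * c 1 t ^ n - c 1 t ^ Suc n / clusters t - deficit t)) (at t)"
    using eventually_gt_at_top[of 0] clusters_at_top[unfolded filterlim_at_top_dense, THEN spec, of 0]
    by eventually_elim (rule DERIV_cong[OF deficit_deriv], auto simp: field_simps)
  have "((\<lambda>t. real n * c 1 t ^ n - c 1 t ^ Suc n * inverse (clusters t)) \<longlongrightarrow>
      real n * 0 ^ n - 0 ^ Suc n * 0) at_top"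
    by (intro tendsto_intros monomers_tendsto_0 tendsto_inverse_0_at_top clusters_at_top)
  then show "((\<lambda>t. real n * c 1 t ^ n - c 1 t ^ Suc n / clusters t) \<longlongrightarrow> 0) at_top"
    using n_ge_2 by (simp add: divide_inverse power_0_left)
qed

lemma deficit_over_monomers_power: "((\<lambda>t. deficit t / c 1 t ^ n) \<longlongrightarrow> real n) at_top"
proof -
  \<comment> \<open>The rate: differentiating the quotient gives \<open>k (n - deficit / c\<^sub>1 ^ n) - c\<^sub>1\<close>.\<close>
  define k where "k = (\<lambda>t. (\<alpha> + (real n - 1) * deficit t) / c 1 t)"
  have c_at_right: "filterlim (c 1) (at_right 0) at_top"
    unfolding filterlim_at
  proof
    show "\<forall>\<^sub>F t in at_top. c 1 t \<in> {0<..} \<and> c 1 t \<noteq> 0"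
      using eventually_gt_at_top[of 0] by eventually_elim (use monomers_pos in force)
  qed (rule monomers_tendsto_0)
  have num: "((\<lambda>t. \<alpha> + (real n - 1) * deficit t) \<longlongrightarrow> \<alpha> + (real n - 1) * 0) at_top"
    by (intro tendsto_intros deficit_tendsto_0)
  have k_top: "filterlim k at_top at_top"
    unfolding k_def divide_inverse using num \<alpha>_pos
    by (intro filterlim_tendsto_pos_mult_at_top[OF num] filterlim_compose[OF filterlim_inverse_at_top_right c_at_right]) auto
  have target: "((\<lambda>t. real n - c 1 t / k t) \<longlongrightarrow> real n) at_top"
  proof -
    have "((\<lambda>t. real n - c 1 t * (c 1 t / (\<alpha> + (real n - 1) * deficit t))) \<longlongrightarrow>
        real n - 0 * (0 / (\<alpha> + (real n - 1) * 0))) at_top"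
      using \<alpha>_pos by (intro tendsto_intros monomers_tendsto_0 deficit_tendsto_0) auto
    then show ?thesis by (simp add: k_def)
  qed
  have "\<forall>\<^sub>F t in at_top. ((\<lambda>t. deficit t / c 1 t ^ n) has_real_derivative
      k t * ((real n - c 1 t / k t) - deficit t / c 1 t ^ n)) (at t)"
    using eventually_gt_at_top[of 0] k_top[unfolded filterlim_at_top_dense, THEN spec, of 0]
  proof eventually_elim
    case (elim t)
    define x where "x = c 1 t"
    define q where "q = deficit t"
    define v where "v = clusters t"
    have x: "x > 0" using monomers_pos elim by (simp add: x_def)
    have v: "v = (\<alpha> - q) / x" using x by (simp add: v_def q_def deficit_def x_def)
    have pow: "((\<lambda>t. c 1 t ^ n) has_real_derivative
        real n * ((\<alpha> - real n * x ^ n - x * v) * x ^ (n - 1))) (at t)"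
      unfolding x_def v_def
      by (rule DERIV_cong[OF DERIV_power[OF ode(1)]]) (use elim in \<open>auto simp: One_nat_def\<close>)
    have "((\<lambda>t. deficit t / c 1 t ^ n) has_real_derivative
       (- ((q - real n * x ^ n) * v + x ^ Suc n) * x ^ n
        - q * (real n * ((\<alpha> - real n * x ^ n - x * v) * x ^ (n - 1)))) / (x ^ n * x ^ n)) (at t)"
      using DERIV_divide[OF deficit_deriv pow] elim x by (simp add: x_def q_def v_def)
    also have "(- ((q - real n * x ^ n) * v + x ^ Suc n) * x ^ n
        - q * (real n * ((\<alpha> - real n * x ^ n - x * v) * x ^ (n - 1)))) / (x ^ n * x ^ n)
      = (real n - q / x ^ n) * ((\<alpha> + (real n - 1) * q) / x) - x"
    proof -
      obtain m where m: "n = Suc m" using n_ge_2 by (cases n) auto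
      define y where "y = x ^ m"
      have y: "y > 0" using x by (simp add: y_def)
      have "x ^ n = x * y" "x ^ (n - 1) = y" "x ^ Suc n = x * (x * y)" by (simp_all add: m y_def)
      then show ?thesis unfolding v using x y by (simp only:) (simp add: field_simps)
    qed
    also have "(\<alpha> + (real n - 1) * q) / x = k t" by (simp add: k_def x_def q_def)
    also have "(real n - q / x ^ n) * k t - x = k t * ((real n - x / k t) - q / x ^ n)"
      using elim by (simp add: right_diff_distrib left_diff_distrib mult.commute)
    finally have "((\<lambda>t. deficit t / c 1 t ^ n) has_real_derivative
      k t * ((real n - x / k t) - q / x ^ n)) (at t)" .
    then show ?case by (simp add: x_def q_def)
  qed
  then show ?thesis by (rule relaxation_tendsto[OF _ k_top target])
qed

lemma power_n: "x ^ n = x * x ^ (n - 1)"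
  using n_ge_2 by (cases n) auto

lemma monomers_times_clusters: "((\<lambda>t. c 1 t * clusters t) \<longlongrightarrow> \<alpha>) at_top"
proof -
  have "((\<lambda>t. \<alpha> - deficit t) \<longlongrightarrow> \<alpha> - 0) at_top"
    by (intro tendsto_intros deficit_tendsto_0)
  then show ?thesis by (simp add: deficit_def)
qed

lemma clusters_power_over_tau:
  "((\<lambda>t. clusters t ^ n / tau c t) \<longlongrightarrow> real n * \<alpha> ^ (n - 1)) at_top"
proof (rule lhospital_at_top_at_top[OF tau_at_top])
  show "\<forall>\<^sub>F t in at_top. c 1 t \<noteq> 0"
    using eventually_gt_at_top[of 0] by eventually_elim (use monomers_pos in force)
  show "\<forall>\<^sub>F t in at_top. ((\<lambda>t. clusters t ^ n) has_real_derivative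
      real n * (c 1 t ^ n * clusters t ^ (n - 1))) (at t)"
    using eventually_gt_at_top[of 0]
    by eventually_elim (rule DERIV_cong[OF DERIV_power[OF clusters_deriv]], auto simp: One_nat_def)
  show "\<forall>\<^sub>F t in at_top. (tau c has_real_derivative c 1 t) (at t)"
    using eventually_gt_at_top[of 0] by eventually_elim (rule tau_deriv)
  have "((\<lambda>t. real n * (c 1 t * clusters t) ^ (n - 1)) \<longlongrightarrow> real n * \<alpha> ^ (n - 1)) at_top"
    by (intro tendsto_intros monomers_times_clusters)
  then show "((\<lambda>t. real n * (c 1 t ^ n * clusters t ^ (n - 1)) / c 1 t) \<longlongrightarrow> real n * \<alpha> ^ (n - 1)) at_top"
  proof (rule Lim_transform_eventually)
    show "\<forall>\<^sub>F t in at_top. real n * (c 1 t * clusters t) ^ (n - 1)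
        = real n * (c 1 t ^ n * clusters t ^ (n - 1)) / c 1 t"
      using eventually_gt_at_top[of 0]
    proof eventually_elim
      case (elim t)
      have "c 1 t ^ n = c 1 t * c 1 t ^ (n - 1)" by (rule power_n)
      then show ?case using monomers_pos[OF elim] by (simp add: power_mult_distrib)
    qed
  qed
qed

lemma eventually_positive:
  "\<forall>\<^sub>F t in at_top. t > 0 \<and> c 1 t > 0 \<and> clusters t > 0 \<and> tau c t > exp 1"
  using eventually_gt_at_top[of 0] clusters_at_top[unfolded filterlim_at_top_dense, THEN spec, of 0]
    tau_at_top[unfolded filterlim_at_top_dense, THEN spec, of "exp 1"]
  by eventually_elim (simp add: monomers_pos)

lemma one_minus_deficit: "1 - deficit t / \<alpha> = c 1 t * clusters t / \<alpha>"
  using \<alpha>_pos by (simp add: deficit_def field_simps)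

text \<open>
  With \<open>c\<^sub>1 * clusters \<approx> \<alpha>\<close> and \<open>clusters ^ n \<approx> n \<alpha> ^ (n - 1) tau\<close>, the deficit \<open>n c\<^sub>1 ^ n\<close> is
  asymptotic to \<open>\<alpha> / tau\<close>.
\<close>

lemma tau_times_deficit: "((\<lambda>t. tau c t * deficit t) \<longlongrightarrow> \<alpha>) at_top"
proof -
  have "((\<lambda>t. deficit t / c 1 t ^ n * (c 1 t * clusters t) ^ n / (clusters t ^ n / tau c t)) \<longlongrightarrow>
      real n * \<alpha> ^ n / (real n * \<alpha> ^ (n - 1))) at_top"
    using n_ge_2 \<alpha>_pos
    by (intro tendsto_intros deficit_over_monomers_power monomers_times_clusters clusters_power_over_tau) auto
  also have "real n * \<alpha> ^ n / (real n * \<alpha> ^ (n - 1)) = \<alpha>"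
    using n_ge_2 \<alpha>_pos power_n[of \<alpha>] by simp
  finally show ?thesis
  proof (rule Lim_transform_eventually)
    show "\<forall>\<^sub>F t in at_top. deficit t / c 1 t ^ n * (c 1 t * clusters t) ^ n / (clusters t ^ n / tau c t)
        = tau c t * deficit t"
      using eventually_positive by eventually_elim (simp add: power_mult_distrib)
  qed
qed

lemma one_minus_power_minus_one_times_tau:
  "((\<lambda>t. ((1 - deficit t / \<alpha>) ^ m - 1) * tau c t) \<longlongrightarrow> - real m) at_top"
proof -
  have "((\<lambda>t. - (tau c t * deficit t / \<alpha>) * (\<Sum>i<m. (1 - deficit t / \<alpha>) ^ i)) \<longlongrightarrow>
      - (\<alpha> / \<alpha>) * (\<Sum>i<m. (1 - 0 / \<alpha>) ^ i)) at_top"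
    using \<alpha>_pos by (intro tendsto_intros tau_times_deficit deficit_tendsto_0) auto
  then show ?thesis
    using \<alpha>_pos by (simp add: power_diff_1_eq mult_ac)
qed

text \<open>
  By \<open>(clusters ^ n)' / n = clusters ^ (n - 1) c\<^sub>1 ^ n = (\<alpha> - deficit) ^ (n - 1) c\<^sub>1\<close>, the
  deficit \<open>\<alpha> / tau\<close> accumulates to the logarithm that dominates the error in the theorem.
\<close>

lemma clusters_log_correction:
  "((\<lambda>t. (clusters t ^ n / (real n * \<alpha> ^ (n - 1)) - tau c t) / ln (tau c t)) \<longlongrightarrow> - (real n - 1)) at_top"
proof (rule lhospital_at_top_at_top)
  show "LIM t at_top. ln (tau c t) :> at_top"
    by (rule filterlim_compose[OF ln_at_top tau_at_top])
  show "\<forall>\<^sub>F t in at_top. c 1 t / tau c t \<noteq> 0"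
    using eventually_positive by eventually_elim (auto simp: less_trans[OF exp_gt_zero])
  show "\<forall>\<^sub>F t in at_top. ((\<lambda>t. clusters t ^ n / (real n * \<alpha> ^ (n - 1)) - tau c t) has_real_derivative
      real n * (c 1 t ^ n * clusters t ^ (n - 1)) / (real n * \<alpha> ^ (n - 1)) - c 1 t) (at t)"
    using eventually_gt_at_top[of 0]
    by eventually_elim
      (intro DERIV_diff DERIV_cdivide tau_deriv DERIV_cong[OF DERIV_power[OF clusters_deriv]], auto simp: One_nat_def)
  show "\<forall>\<^sub>F t in at_top. ((\<lambda>t. ln (tau c t)) has_real_derivative c 1 t / tau c t) (at t)"
    using eventually_positive
  proof eventually_elim
    case (elim t)
    then have "tau c t > 0" using less_trans[OF exp_gt_zero] by blast
    from DERIV_chain2[OF DERIV_ln_divide[OF this] tau_deriv] elim show ?case by simp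
  qed
  have "((\<lambda>t. ((1 - deficit t / \<alpha>) ^ (n - 1) - 1) * tau c t) \<longlongrightarrow> - (real n - 1)) at_top"
    using one_minus_power_minus_one_times_tau[of "n - 1"] n_ge_2 by (simp add: of_nat_diff)
  then show "((\<lambda>t. (real n * (c 1 t ^ n * clusters t ^ (n - 1)) / (real n * \<alpha> ^ (n - 1)) - c 1 t)
      / (c 1 t / tau c t)) \<longlongrightarrow> - (real n - 1)) at_top"
  proof (rule Lim_transform_eventually)
    show "\<forall>\<^sub>F t in at_top. ((1 - deficit t / \<alpha>) ^ (n - 1) - 1) * tau c t =
       (real n * (c 1 t ^ n * clusters t ^ (n - 1)) / (real n * \<alpha> ^ (n - 1)) - c 1 t) / (c 1 t / tau c t)"
      using eventually_positive
    proof eventually_elim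
      case (elim t)
      have "c 1 t ^ n = c 1 t * c 1 t ^ (n - 1)" by (rule power_n)
      moreover have "(1 - deficit t / \<alpha>) ^ (n - 1) = c 1 t ^ (n - 1) * clusters t ^ (n - 1) / \<alpha> ^ (n - 1)"
        by (simp add: one_minus_deficit power_mult_distrib power_divide)
      moreover have "tau c t > 0" using elim less_trans[OF exp_gt_zero] by blast
      ultimately show ?case
        using elim \<alpha>_pos n_ge_2 by (simp add: diff_divide_distrib left_diff_distrib)
    qed
  qed
qed

definition expo :: real where
  "expo = (real n - 1) / real n"

lemma expo_bounds: "0 < expo" "expo < 1"
  using n_ge_2 by (auto simp: expo_def)

lemma power_powr_expo: "x > 0 \<Longrightarrow> (x ^ n) powr expo = x ^ (n - 1)"
  using n_ge_2 by (simp add: expo_def powr_powr of_nat_diff flip: powr_realpow)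

lemma scaled_monomers_eq:
  assumes "c 1 t > 0" "clusters t > 0" "tau c t > 0"
  shows "(real n * tau c t / \<alpha>) powr expo * c 1 t ^ (n - 1)
    = (1 - deficit t / \<alpha>) ^ (n - 1) * (clusters t ^ n / (real n * \<alpha> ^ (n - 1) * tau c t)) powr (- expo)"
proof -
  have n: "real n > 0" using n_ge_2 by simp
  have \<alpha>_n: "\<alpha> ^ n = \<alpha> * \<alpha> ^ (n - 1)" by (rule power_n)
  have base: "real n * \<alpha> ^ (n - 1) * tau c t = (real n * tau c t / \<alpha>) * \<alpha> ^ n"
    using \<alpha>_pos by (simp add: \<alpha>_n)
  have "(real n * \<alpha> ^ (n - 1) * tau c t) powr expo = (real n * tau c t / \<alpha>) powr expo * \<alpha> ^ (n - 1)"
    unfolding base using assms n \<alpha>_pos by (subst powr_mult) (simp_all add: power_powr_expo)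
  then have eq: "(clusters t ^ n / (real n * \<alpha> ^ (n - 1) * tau c t)) powr (- expo)
      = (real n * tau c t / \<alpha>) powr expo * \<alpha> ^ (n - 1) / clusters t ^ (n - 1)"
    using assms \<alpha>_pos n by (simp add: powr_minus powr_divide power_powr_expo)
  show ?thesis
    unfolding eq one_minus_deficit using assms \<alpha>_pos by (simp add: power_mult_distrib power_divide)
qed

text \<open>
  In the factorisation above the second factor is \<open>(1 + D e) powr (- expo)\<close> with
  \<open>e = ln tau / tau\<close> and \<open>D\<close> tending to \<open>- (n - 1)\<close>. It carries the logarithm; the first factor
  is \<open>1 + O(1 / tau)\<close>.
\<close>

lemma scaled_monomers_log_correction:
  "((\<lambda>t. ((real n * tau c t / \<alpha>) powr expo * c 1 t ^ (n - 1) - 1) * (tau c t / ln (tau c t)))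
    \<longlongrightarrow> (real n - 1) * expo) at_top"
proof -
  define D where "D = (\<lambda>t. (clusters t ^ n / (real n * \<alpha> ^ (n - 1)) - tau c t) / ln (tau c t))"
  define e where "e = (\<lambda>t. ln (tau c t) / tau c t)"
  define P where "P = (\<lambda>t. (1 - deficit t / \<alpha>) ^ (n - 1))"
  have D: "(D \<longlongrightarrow> - (real n - 1)) at_top"
    unfolding D_def by (rule clusters_log_correction)
  have "((\<lambda>s::real. ln s / s) \<longlongrightarrow> 0) at_top" by real_asymp
  then have e: "(e \<longlongrightarrow> 0) at_top"
    unfolding e_def by (rule filterlim_compose[OF _ tau_at_top])
  have P: "(P \<longlongrightarrow> (1 - 0 / \<alpha>) ^ (n - 1)) at_top"
    unfolding P_def using \<alpha>_pos by (intro tendsto_intros deficit_tendsto_0) auto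
  have "((\<lambda>z. z powr (- expo)) has_real_derivative - expo * 1 powr (- expo - 1)) (at (1::real))"
    by (rule has_real_derivative_powr) simp
  \<comment> \<open>The slope \<open>g\<close> is continuous at \<open>1\<close>, so that zeros of \<open>D e\<close> need no separate treatment.\<close>
  then obtain g where g: "\<And>z. z powr (- expo) - 1 = g z * (z - 1)" "isCont g 1" "g 1 = - expo"
    unfolding CARAT_DERIV by auto
  have "((\<lambda>t. 1 + D t * e t) \<longlongrightarrow> 1 + - (real n - 1) * 0) at_top"
    by (intro tendsto_intros D e)
  then have gD: "((\<lambda>t. g (1 + D t * e t)) \<longlongrightarrow> - expo) at_top"
    using isCont_tendsto_compose[OF g(2), of "\<lambda>t. 1 + D t * e t"] g(3) by simp
  have "((\<lambda>t. ((1 - deficit t / \<alpha>) ^ (n - 1) - 1) * tau c t * inverse (ln (tau c t))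
      + P t * g (1 + D t * e t) * D t) \<longlongrightarrow> - real (n - 1) * 0 + (1 - 0 / \<alpha>) ^ (n - 1) * (- expo) * - (real n - 1)) at_top"
    by (intro tendsto_intros P gD D one_minus_power_minus_one_times_tau tendsto_inverse_0_at_top
        filterlim_compose[OF ln_at_top tau_at_top])
  then have "((\<lambda>t. ((1 - deficit t / \<alpha>) ^ (n - 1) - 1) * tau c t * inverse (ln (tau c t))
      + P t * g (1 + D t * e t) * D t) \<longlongrightarrow> (real n - 1) * expo) at_top"
    by (simp add: algebra_simps)
  then show ?thesis
  proof (rule Lim_transform_eventually)
    show "\<forall>\<^sub>F t in at_top. ((1 - deficit t / \<alpha>) ^ (n - 1) - 1) * tau c t * inverse (ln (tau c t))
        + P t * g (1 + D t * e t) * D t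
      = ((real n * tau c t / \<alpha>) powr expo * c 1 t ^ (n - 1) - 1) * (tau c t / ln (tau c t))"
      using eventually_positive
    proof eventually_elim
      case (elim t)
      have tau: "tau c t > 0" using elim less_trans[OF exp_gt_zero] by blast
      have "tau c t > 1" using elim by (meson less_trans one_less_exp_iff zero_less_one)
      then have ln: "ln (tau c t) > 0" by simp
      have z: "1 + D t * e t = clusters t ^ n / (real n * \<alpha> ^ (n - 1) * tau c t)"
        using tau ln by (simp add: D_def e_def field_simps)
      have "(1 + D t * e t) powr (- expo) = 1 + g (1 + D t * e t) * (D t * e t)"
        using g(1)[of "1 + D t * e t"] by simp
      then have "(real n * tau c t / \<alpha>) powr expo * c 1 t ^ (n - 1) = P t * (1 + g (1 + D t * e t) * (D t * e t))"
        using scaled_monomers_eq[of t] elim tau unfolding z by (simp add: P_def)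
      then show ?case
        using tau ln by (simp add: P_def e_def field_simps)
    qed
  qed
qed

text \<open>The relative deviation of \<open>c 1 ^ (n - 1)\<close> from its leading-order value at rescaled time \<open>s\<close>.\<close>

definition monomer_excess :: "real \<Rightarrow> real" where
  "monomer_excess s = (real n * s / \<alpha>) powr expo * c 1 (time_of c s) ^ (n - 1) - 1"

lemma monomer_excess_asymptotics:
  "((\<lambda>s. monomer_excess s * (s / ln s)) \<longlongrightarrow> (real n - 1) * expo) at_top"
  using filterlim_compose[OF scaled_monomers_log_correction time_of_at_top]
proof (rule Lim_transform_eventually)
  show "\<forall>\<^sub>F s in at_top. ((real n * tau c (time_of c s) / \<alpha>) powr expo * c 1 (time_of c s) ^ (n - 1) - 1)
      * (tau c (time_of c s) / ln (tau c (time_of c s))) = monomer_excess s * (s / ln s)"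
    using eventually_ge_at_top[of 0] by eventually_elim (simp add: tau_time_of monomer_excess_def)
qed

section \<open>The concentrations in rescaled time\<close>

lemma continuous_on_time_of:
  assumes "T \<ge> 0"
  shows "continuous_on {0..T} (time_of c)"
proof -
  have "continuous_on (tau c ` {0..time_of c T}) (time_of c)"
    by (rule continuous_on_inv[OF continuous_on_subset[OF continuous_on_tau]])
       (auto simp: time_of_tau)
  moreover have "{0..T} \<subseteq> tau c ` {0..time_of c T}"
  proof
    fix y assume y: "y \<in> {0..T}"
    have "time_of c y \<le> time_of c T"
      using time_of_strict_mono[of y T] y by (cases "y = T") auto
    then have "time_of c y \<in> {0..time_of c T}" using tau_time_of(1)[of y] y by auto
    then show "y \<in> tau c ` {0..time_of c T}"
      using tau_time_of(2)[of y] y by (metis atLeastAtMost_iff imageI)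
  qed
  ultimately show ?thesis by (rule continuous_on_subset)
qed

lemma time_of_pos: "s > 0 \<Longrightarrow> time_of c s > 0"
  using time_of_strict_mono[of 0 s] by simp

lemma time_of_deriv:
  assumes "s > 0"
  shows "(time_of c has_real_derivative inverse (c 1 (time_of c s))) (at s)"
proof (rule DERIV_inverse_function[where f = "tau c" and a = 0 and b = "s + 1"])
  show "(tau c has_real_derivative c 1 (time_of c s)) (at (time_of c s))"
    by (intro tau_deriv time_of_pos assms)
  show "c 1 (time_of c s) \<noteq> 0"
    using monomers_pos[OF time_of_pos[OF assms]] by simp
  show "isCont (time_of c) s"
    using continuous_on_interior[OF continuous_on_time_of, of "s + 1" s] assms by simp
qed (use assms tau_time_of in auto)

lemma ctilde_deriv:
  assumes "s > 0"
  shows "(ctilde c n has_real_derivative c 1 (time_of c s) ^ (n - 1) - ctilde c n s) (at s)"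
    and "j > n \<Longrightarrow> (ctilde c j has_real_derivative ctilde c (j - 1) s - ctilde c j s) (at s)"
proof -
  define t where "t = time_of c s"
  have t: "t > 0" unfolding t_def by (rule time_of_pos[OF assms])
  note c_pos = monomers_pos[OF t]
  have "((\<lambda>s. c n (time_of c s)) has_real_derivative (c 1 t ^ n - c 1 t * c n t) * inverse (c 1 t)) (at s)"
    unfolding t_def by (intro DERIV_chain2[where g = "time_of c"] ode time_of_deriv assms time_of_pos)
  moreover have "(c 1 t ^ n - c 1 t * c n t) * inverse (c 1 t) = c 1 t ^ (n - 1) - c n t"
    using c_pos power_n[of "c 1 t"] by (simp add: field_simps)
  ultimately show "(ctilde c n has_real_derivative c 1 (time_of c s) ^ (n - 1) - ctilde c n s) (at s)"
    by (simp add: ctilde_def[abs_def] t_def)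
  assume j: "j > n"
  have "((\<lambda>s. c j (time_of c s)) has_real_derivative (c 1 t * c (j - 1) t - c 1 t * c j t) * inverse (c 1 t)) (at s)"
    unfolding t_def by (intro DERIV_chain2[where g = "time_of c"] ode time_of_deriv assms time_of_pos j)
  moreover have "(c 1 t * c (j - 1) t - c 1 t * c j t) * inverse (c 1 t) = c (j - 1) t - c j t"
    using c_pos by (simp add: field_simps)
  ultimately show "(ctilde c j has_real_derivative ctilde c (j - 1) s - ctilde c j s) (at s)"
    by (simp add: ctilde_def[abs_def] t_def)
qed

lemma continuous_on_ctilde:
  assumes "T \<ge> 0" "j \<ge> n"
  shows "continuous_on {0..T} (ctilde c j)"
  unfolding ctilde_def[abs_def]
  by (rule continuous_on_compose2[OF continuous_on_c(2)[OF assms(2)] continuous_on_time_of[OF assms(1)]])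
     (auto simp: tau_time_of)

text \<open>The value \<open>0\<close> at negative times lets averages run over delays of any length.\<close>

definition creation_rate :: "real \<Rightarrow> real" where
  "creation_rate s = (if s < 0 then 0 else c 1 (time_of c s) ^ (n - 1))"

lemma creation_rate_bounds: "0 \<le> creation_rate s" "creation_rate s \<le> monomer_bound ^ (n - 1)"
proof -
  show "0 \<le> creation_rate s"
    using nonneg(1) tau_time_of(1) by (simp add: creation_rate_def)
  show "creation_rate s \<le> monomer_bound ^ (n - 1)"
  proof (cases "s < 0")
    case True
    then show ?thesis using monomer_bound_ge_1 by (simp add: creation_rate_def)
  next
    case False
    then have "time_of c s \<ge> 0" using tau_time_of(1) by simp
    then have "c 1 (time_of c s) ^ (n - 1) \<le> monomer_bound ^ (n - 1)"
      by (intro power_mono monomers_le nonneg)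
    then show ?thesis using False by (simp add: creation_rate_def)
  qed
qed

text \<open>Clusters present at time \<open>0\<close> that have grown to index \<open>j\<close>; the summation index counts the steps.\<close>

definition initial_part :: "nat \<Rightarrow> real \<Rightarrow> real" where
  "initial_part j T = (\<Sum>i\<le>j - n. erlang i T * c (j - i) 0)"

lemma ctilde_representation:
  assumes T: "T \<ge> 0" and j: "j \<ge> n"
  shows "((\<lambda>s. erlang (j - n) s * creation_rate (T - s)) has_integral ctilde c j T - initial_part j T) {0..T}"
proof -
  have "((\<lambda>s. erlang (j - n) s * creation_rate (T - s)) has_integral
    ctilde c (n + (j - n)) T - (\<Sum>k\<le>j - n. erlang (j - n - k) T * ctilde c (n + k) 0)) {0..T}"
  proof (rule chain_representation[OF T])
    show "continuous_on {0..T} (ctilde c (n + k))" for k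
      by (rule continuous_on_ctilde[OF T]) simp
    fix s :: real assume s: "0 < s" "s < T"
    show "(ctilde c (n + 0) has_real_derivative creation_rate s - ctilde c (n + 0) s) (at s)"
      using ctilde_deriv(1)[OF s(1)] s by (simp add: creation_rate_def)
    show "(ctilde c (n + Suc k) has_real_derivative ctilde c (n + k) s - ctilde c (n + Suc k) s) (at s)" for k
      using ctilde_deriv(2)[OF s(1), of "n + Suc k"] by simp
  qed
  also have "(\<Sum>k\<le>j - n. erlang (j - n - k) T * ctilde c (n + k) 0) = initial_part j T"
    unfolding initial_part_def
    by (rule sum.reindex_bij_witness[of _ "\<lambda>i. j - n - i" "\<lambda>i. j - n - i"]) (use j in \<open>auto simp: ctilde_def\<close>)
  finally show ?thesis using j by simp
qed

lemma ctilde_le: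
  assumes T: "T \<ge> 0" and j: "j \<ge> n" and E: "\<And>s. 0 \<le> s \<Longrightarrow> s \<le> T \<Longrightarrow> erlang (j - n) s \<le> E"
  shows "ctilde c j T \<le> initial_part j T + E * monomer_bound ^ (n - 1) * T"
proof -
  have "((\<lambda>s. E * monomer_bound ^ (n - 1)) has_integral E * monomer_bound ^ (n - 1) * T) {0..T}"
    using has_integral_const_real[of "E * monomer_bound ^ (n - 1)" 0 T] T by (simp add: mult.commute)
  then have "ctilde c j T - initial_part j T \<le> E * monomer_bound ^ (n - 1) * T"
  proof (rule has_integral_le[OF ctilde_representation[OF T j]])
    fix s assume s: "s \<in> {0..T}"
    then have "0 \<le> E" using E[of s] erlang_nonneg[of s "j - n"] by force
    then show "erlang (j - n) s * creation_rate (T - s) \<le> E * monomer_bound ^ (n - 1)"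
      using s by (intro mult_mono E creation_rate_bounds) auto
  qed
  then show ?thesis by simp
qed

lemma ctilde_nonneg: "T \<ge> 0 \<Longrightarrow> j \<ge> n \<Longrightarrow> ctilde c j T \<ge> 0"
  unfolding ctilde_def by (intro nonneg tau_time_of)

lemma initial_part_nonneg: "T \<ge> 0 \<Longrightarrow> j \<ge> n \<Longrightarrow> initial_part j T \<ge> 0"
  unfolding initial_part_def by (intro sum_nonneg mult_nonneg_nonneg erlang_nonneg nonneg) auto

end

locale decaying_initial_data = nucleation_chain +
  fixes \<rho> \<mu> :: real
  assumes \<rho>_pos: "\<rho> > 0" and \<mu>_pos: "\<mu> > 0"
    and initial_le: "\<And>j. j \<ge> n \<Longrightarrow> c j 0 \<le> \<rho> * real j powr (- \<mu>)"
begin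

lemma initial_le_const:
  assumes "j \<ge> n"
  shows "c j 0 \<le> \<rho>"
proof -
  have "real j powr (- \<mu>) \<le> 1"
    using assms n_ge_2 \<mu>_pos by (simp add: powr_minus ge_one_powr_ge_zero inverse_le_1_iff)
  then have "\<rho> * real j powr (- \<mu>) \<le> \<rho>" using \<rho>_pos by (intro mult_left_le) auto
  then show ?thesis using initial_le[OF assms] by simp
qed

text \<open>Behind the front the initial clusters survive only in the lower tail of a Poisson law.\<close>

lemma initial_part_behind_front:
  assumes "0 < \<eta>" "\<eta> < 1" "j \<ge> n"
  shows "initial_part j (real j / \<eta>) \<le> \<rho> * exp (- poisson_rate \<eta> * (real j / \<eta>))"
proof -
  define T where "T = real j / \<eta>"
  have T: "T \<ge> 0" "real j = \<eta> * T" using assms by (auto simp: T_def)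
  have "initial_part j T \<le> (\<Sum>i\<le>j - n. \<rho> / \<eta> ^ j * (\<eta> ^ i * erlang i T))"
    unfolding initial_part_def
  proof (rule sum_mono)
    fix i assume i: "i \<in> {..j - n}"
    have "erlang i T * c (j - i) 0 \<le> erlang i T * \<rho>"
      using i assms T by (intro mult_left_mono initial_le_const erlang_nonneg) auto
    also have "\<dots> \<le> \<rho> * erlang i T * (\<eta> ^ i / \<eta> ^ j)"
    proof -
      have "1 \<le> \<eta> ^ i / \<eta> ^ j"
        using i assms power_decreasing[of i j \<eta>] by simp
      then show ?thesis
        using mult_left_mono[of 1 "\<eta> ^ i / \<eta> ^ j" "\<rho> * erlang i T"] \<rho>_pos erlang_nonneg[OF T(1), of i]
        by (simp add: mult.commute)
    qed
    finally show "erlang i T * c (j - i) 0 \<le> \<rho> / \<eta> ^ j * (\<eta> ^ i * erlang i T)" by (simp add: mult_ac)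
  qed
  also have "\<dots> = \<rho> / \<eta> ^ j * (\<Sum>i\<le>j - n. \<eta> ^ i * erlang i T)"
    by (simp add: sum_distrib_left)
  also have "\<dots> \<le> \<rho> / \<eta> ^ j * exp ((\<eta> - 1) * T)"
    using \<rho>_pos assms by (intro mult_left_mono sum_erlang_tilted_le T) auto
  also have "\<dots> = \<rho> * (exp ((\<eta> - 1) * T) / \<eta> powr (\<eta> * T))"
    using assms by (simp add: powr_realpow flip: T(2))
  finally show ?thesis unfolding exp_tilt_div_powr[OF assms(1)] unfolding T_def .
qed

text \<open>
  Ahead of the front most of the mass that reaches index \<open>j\<close> started at an index of order \<open>j\<close>,
  and only the upper tail of a Poisson law connects the small indices to \<open>j\<close>; the split
  is at a fraction \<open>\<theta>\<close> of \<open>j\<close>, between the mean \<open>j / \<eta>\<close> of that law and \<open>j\<close>.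
\<close>

lemma initial_part_ahead_of_front:
  assumes \<eta>: "\<eta> > 1" and \<theta>: "1 < \<theta> * \<eta>" "\<theta> < 1" and j: "j \<ge> n"
  shows "initial_part j (real j / \<eta>)
    \<le> \<rho> * ((1 - \<theta>) * real j) powr (- \<mu>) + \<rho> * exp (- poisson_rate (\<theta> * \<eta>) * (real j / \<eta>))"
proof -
  define T where "T = real j / \<eta>"
  define r where "r = \<theta> * \<eta>"
  have T: "T \<ge> 0" "\<theta> * real j = r * T" using \<eta> by (auto simp: T_def r_def)
  have r: "r > 1" using \<theta> by (simp add: r_def)
  have j0: "j > 0" using j n_ge_2 by simp
  have "initial_part j T \<le> (\<Sum>i\<le>j - n. \<rho> * ((1 - \<theta>) * real j) powr (- \<mu>) * (1 ^ i * erlang i T)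
      + \<rho> / r powr (r * T) * (r ^ i * erlang i T))"
    unfolding initial_part_def
  proof (rule sum_mono)
    fix i assume i: "i \<in> {..j - n}"
    have e: "erlang i T \<ge> 0" by (rule erlang_nonneg[OF T(1)])
    have "c (j - i) 0 \<le> \<rho> * ((1 - \<theta>) * real j) powr (- \<mu>) + \<rho> / r powr (r * T) * r ^ i"
    proof (cases "real i \<le> \<theta> * real j")
      case True
      have "c (j - i) 0 \<le> \<rho> * real (j - i) powr (- \<mu>)"
        using i j by (intro initial_le) auto
      also have "real (j - i) powr (- \<mu>) \<le> ((1 - \<theta>) * real j) powr (- \<mu>)"
        using i j True \<theta> j0 \<mu>_pos by (intro powr_mono2') (auto simp: of_nat_diff algebra_simps)
      finally have "c (j - i) 0 \<le> \<rho> * ((1 - \<theta>) * real j) powr (- \<mu>)"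
        using \<rho>_pos by simp
      moreover have "\<rho> / r powr (r * T) * r ^ i \<ge> 0" using \<rho>_pos r by simp
      ultimately show ?thesis by linarith
    next
      case False
      have "r powr (r * T) \<le> r powr real i"
        using False r T(2) by (intro powr_mono) auto
      then have "1 \<le> r ^ i / r powr (r * T)" using r by (simp add: powr_realpow)
      from mult_left_mono[OF this, of \<rho>] have "\<rho> \<le> \<rho> * (r ^ i / r powr (r * T))"
        using \<rho>_pos by simp
      moreover have "c (j - i) 0 \<le> \<rho>" using i j by (intro initial_le_const) auto
      moreover have "\<rho> * ((1 - \<theta>) * real j) powr (- \<mu>) \<ge> 0" using \<rho>_pos by simp
      ultimately show ?thesis by simp
    qed
    from mult_left_mono[OF this e]
    show "erlang i T * c (j - i) 0 \<le> \<rho> * ((1 - \<theta>) * real j) powr (- \<mu>) * (1 ^ i * erlang i T)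
      + \<rho> / r powr (r * T) * (r ^ i * erlang i T)"
      by (simp add: algebra_simps)
  qed
  also have "\<dots> = \<rho> * ((1 - \<theta>) * real j) powr (- \<mu>) * (\<Sum>i\<le>j - n. 1 ^ i * erlang i T)
      + \<rho> / r powr (r * T) * (\<Sum>i\<le>j - n. r ^ i * erlang i T)"
    by (simp add: sum.distrib sum_distrib_left)
  also have "\<dots> \<le> \<rho> * ((1 - \<theta>) * real j) powr (- \<mu>) * exp ((1 - 1) * T)
      + \<rho> / r powr (r * T) * exp ((r - 1) * T)"
    using \<rho>_pos r by (intro add_mono mult_left_mono sum_erlang_tilted_le T) auto
  also have "\<dots> = \<rho> * ((1 - \<theta>) * real j) powr (- \<mu>) + \<rho> * (exp ((r - 1) * T) / r powr (r * T))"
    by simp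
  also have "exp ((r - 1) * T) / r powr (r * T) = exp (- poisson_rate r * T)"
    using r by (intro exp_tilt_div_powr) simp
  finally show ?thesis unfolding T_def r_def .
qed

section \<open>Ahead of the front\<close>

text \<open>
  Clusters created after time \<open>0\<close> would need a delay of at most \<open>j / \<eta> < j\<close> to pass \<open>j - n + 1\<close>
  stages, which is exponentially unlikely; what remains is the transported initial tail of order
  \<open>j powr (- \<mu>)\<close>.
\<close>

lemma ctilde_ahead_of_front:
  assumes \<eta>: "\<eta> > 1"
  shows "(\<lambda>j. real j powr \<mu> * ctilde c j (real j / \<eta>)) \<in> O(\<lambda>_. 1)"
proof -
  define \<theta> where "\<theta> = (1 + 1 / \<eta>) / 2"
  have \<theta>: "1 < \<theta> * \<eta>" "\<theta> < 1" "\<theta> > 0" using \<eta> by (auto simp: \<theta>_def field_simps)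
  define p where "p = poisson_rate (\<theta> * \<eta>)"
  define q where "q = poisson_rate \<eta>"
  define U where "U = monomer_bound ^ (n - 1)"
  have p: "p > 0" unfolding p_def using \<theta> by (intro poisson_rate_pos) auto
  have q: "q > 0" unfolding q_def using \<eta> by (intro poisson_rate_pos) auto
  have U: "U \<ge> 0" using monomer_bound_ge_1 by (simp add: U_def)
  have bound: "real j powr \<mu> * ctilde c j (real j / \<eta>) \<le>
      \<rho> * (1 - \<theta>) powr (- \<mu>) + \<rho> * (real j powr \<mu> * exp (- p * (real j / \<eta>)))
      + \<eta> ^ n * U * (real j powr \<mu> * (exp (- q * (real j / \<eta>)) * (real j / \<eta>)))"
    if j: "j \<ge> n" for j
  proof -
    define T where "T = real j / \<eta>"
    have T: "T \<ge> 0" "real j = \<eta> * T" and j0: "j > 0" using \<eta> j n_ge_2 by (auto simp: T_def)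
    have "erlang (j - n) s \<le> \<eta> ^ n * exp (- q * T)" if "0 \<le> s" "s \<le> T" for s
    proof -
      have "erlang (j - n) s \<le> exp ((\<eta> - 1) * s) / \<eta> ^ (j - n)"
        using that \<eta> by (intro erlang_le_tilted) auto
      also have "\<dots> \<le> exp ((\<eta> - 1) * T) / \<eta> ^ (j - n)"
        using that \<eta> by (intro divide_right_mono) auto
      also have "\<dots> = \<eta> ^ n * (exp ((\<eta> - 1) * T) / \<eta> ^ j)"
        using \<eta> j by (simp add: power_diff)
      also have "\<eta> ^ j = \<eta> powr (\<eta> * T)"
        using \<eta> by (simp add: powr_realpow flip: T(2))
      also have "exp ((\<eta> - 1) * T) / \<eta> powr (\<eta> * T) = exp (- q * T)"
        unfolding q_def using \<eta> by (intro exp_tilt_div_powr) simp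
      finally show ?thesis .
    qed
    from ctilde_le[OF T(1) j this]
    have "ctilde c j T \<le> initial_part j T + \<eta> ^ n * exp (- q * T) * U * T"
      by (simp add: U_def)
    moreover have "initial_part j T \<le> \<rho> * ((1 - \<theta>) * real j) powr (- \<mu>) + \<rho> * exp (- p * T)"
      unfolding T_def p_def by (intro initial_part_ahead_of_front \<eta> \<theta> j)
    ultimately have "real j powr \<mu> * ctilde c j T \<le>
       real j powr \<mu> * (\<rho> * ((1 - \<theta>) * real j) powr (- \<mu>) + \<rho> * exp (- p * T) + \<eta> ^ n * exp (- q * T) * U * T)"
      by (intro mult_left_mono) auto
    also have "((1 - \<theta>) * real j) powr (- \<mu>) = (1 - \<theta>) powr (- \<mu>) * real j powr (- \<mu>)"
      by (rule powr_mult)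
    also have "real j powr \<mu> * (\<rho> * ((1 - \<theta>) powr (- \<mu>) * real j powr (- \<mu>)) + \<rho> * exp (- p * T) + \<eta> ^ n * exp (- q * T) * U * T)
      = \<rho> * (1 - \<theta>) powr (- \<mu>) * (real j powr \<mu> * real j powr (- \<mu>)) + \<rho> * (real j powr \<mu> * exp (- p * T))
        + \<eta> ^ n * U * (real j powr \<mu> * (exp (- q * T) * T))"
      by (simp add: algebra_simps)
    also have "real j powr \<mu> * real j powr (- \<mu>) = 1" using j0 by (simp flip: powr_add)
    finally show ?thesis by (simp add: T_def)
  qed
  have "((\<lambda>x::real. x powr \<mu> * exp (- p * (x / \<eta>))) \<longlongrightarrow> 0) at_top"
    using p \<eta> by real_asymp
  then have lim1: "(\<lambda>j. real j powr \<mu> * exp (- p * (real j / \<eta>))) \<longlonglongrightarrow> 0"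
    by (rule filterlim_compose[OF _ filterlim_real_sequentially])
  have "((\<lambda>x::real. x powr \<mu> * (exp (- q * (x / \<eta>)) * (x / \<eta>))) \<longlongrightarrow> 0) at_top"
    using q \<eta> by real_asymp
  then have lim2: "(\<lambda>j. real j powr \<mu> * (exp (- q * (real j / \<eta>)) * (real j / \<eta>))) \<longlonglongrightarrow> 0"
    by (rule filterlim_compose[OF _ filterlim_real_sequentially])
  define X where "X = \<rho> * (1 - \<theta>) powr (- \<mu>)"
  have "(\<lambda>j. X + \<rho> * (real j powr \<mu> * exp (- p * (real j / \<eta>)))
      + \<eta> ^ n * U * (real j powr \<mu> * (exp (- q * (real j / \<eta>)) * (real j / \<eta>)))) \<longlonglongrightarrow>
      X + \<rho> * 0 + \<eta> ^ n * U * 0"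
    by (intro tendsto_intros lim1 lim2)
  from order_tendstoD(2)[OF this, of "X + 1"]
  have "\<forall>\<^sub>F j in sequentially. X + \<rho> * (real j powr \<mu> * exp (- p * (real j / \<eta>)))
      + \<eta> ^ n * U * (real j powr \<mu> * (exp (- q * (real j / \<eta>)) * (real j / \<eta>))) < X + 1"
    by simp
  then have "\<forall>\<^sub>F j in sequentially. norm (real j powr \<mu> * ctilde c j (real j / \<eta>)) \<le> (X + 1) * norm (1::real)"
    using eventually_ge_at_top[of n]
  proof eventually_elim
    case (elim j)
    then have "real j powr \<mu> * ctilde c j (real j / \<eta>) \<le> X + 1"
      using bound[of j] by (simp add: X_def)
    moreover have "ctilde c j (real j / \<eta>) \<ge> 0" using \<eta> elim by (intro ctilde_nonneg) auto
    ultimately show ?case by simp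
  qed
  then show ?thesis by (rule bigoI)
qed

section \<open>Behind the front\<close>

text \<open>
  A cluster of index \<open>j\<close> at rescaled time \<open>j / \<eta>\<close> was created around time \<open>L j\<close>, and the creation
  rate is averaged over delays with the Erlang law of mean \<open>j - n + 1\<close>. The logarithmic correction of
  the rate, of relative size \<open>ln L / L\<close>, dominates the averaging error \<open>1 / L\<close> and the
  exponentially small trace of the initial data.
\<close>

lemma ctilde_behind_front:
  assumes \<eta>: "0 < \<eta>" "\<eta> < 1"
  defines "L \<equiv> \<lambda>j. real j / \<eta> - real j"
  shows "(\<lambda>j. ((real n * L j / \<alpha>) powr expo * ctilde c j (real j / \<eta>) - 1) * (L j / ln (L j)))
    \<longlonglongrightarrow> (real n - 1) * expo"
proof (rule tendstoI)
  fix \<epsilon> :: real assume \<epsilon>: "\<epsilon> > 0"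
  define B where "B = (real n / \<alpha>) powr expo"
  define \<kappa> where "\<kappa> = (real n - 1) * expo"
  define g where "g = \<eta> / (1 - \<eta>)"
  define d where "d = real n - 1"
  define p where "p = poisson_rate \<eta>"
  have B: "B \<ge> 0" by (simp add: B_def)
  have g: "g > 0" using \<eta> by (simp add: g_def)
  have p: "p > 0" unfolding p_def using \<eta> by (intro poisson_rate_pos) auto
  have jL: "real j = g * L j" "real j / \<eta> = L j / (1 - \<eta>)" for j
    using \<eta> by (auto simp: L_def g_def field_simps)
  have L_top: "filterlim L at_top sequentially"
  proof -
    have "1 / \<eta> - 1 > 0" using \<eta> by simp
    then have "filterlim (\<lambda>j. (1 / \<eta> - 1) * real j) at_top sequentially"
      by (intro filterlim_tendsto_pos_mult_at_top[OF tendsto_const] filterlim_real_sequentially)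
    then show ?thesis by (simp add: L_def algebra_simps)
  qed
  have U: "creation_rate x \<le> monomer_bound ^ (n - 1)" for x by (rule creation_rate_bounds)
  have "B * x powr expo * creation_rate x = 1 + monomer_excess x" if "x > 0" for x
    using that \<alpha>_pos n_ge_2
    by (simp add: B_def creation_rate_def monomer_excess_def powr_mult powr_divide)
  note input = decaying_input_near_tangent[OF _ _ B creation_rate_bounds(1) U this
      monomer_excess_asymptotics[folded \<kappa>_def], of "\<epsilon> / 2"]
  obtain C L0 where L0: "L0 > exp 1" and C: "C \<ge> 0"
    and tangent: "\<And>L x. L \<ge> L0 \<Longrightarrow>
      \<bar>B * L powr expo * creation_rate x - (1 - expo * ((x - L) / L) + \<kappa> * (ln L / L))\<bar>
      \<le> \<epsilon> / 2 * (ln L / L) + 2 * ((x - L) / L)\<^sup>2 + C * L * ((x - L) / L) ^ 4"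
    by (rule input) (use expo_bounds \<epsilon> in auto)
  \<comment> \<open>The errors relative to \<open>ln L / L\<close>: the shift of the mean delay by \<open>d\<close>, the second and fourth
    moments, and the initial data. Here \<open>j = g L\<close>, and \<open>g L - d\<close> is the number of stages.\<close>
  define err where "err = (\<lambda>L. expo * d * (L / ln L * (1 / L))
      + 2 * (L / ln L * ((d\<^sup>2 + (g * L - d)) / L\<^sup>2))
      + C * (L / ln L * (L * ((d ^ 4 + 6 * (g * L - d) * d\<^sup>2 - 8 * (g * L - d) * d
          + 3 * (g * L - d)\<^sup>2 + 6 * (g * L - d)) / L ^ 4)))
      + B * \<rho> * (L / ln L * (L * exp (- p * (L / (1 - \<eta>))))))"
  have "(err \<longlongrightarrow> expo * d * 0 + 2 * 0 + C * 0 + B * \<rho> * 0) at_top"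
    unfolding err_def
  proof (intro tendsto_add tendsto_mult_left)
    show "((\<lambda>L::real. L / ln L * (1 / L)) \<longlongrightarrow> 0) at_top" by real_asymp
    show "((\<lambda>L::real. L / ln L * ((d\<^sup>2 + (g * L - d)) / L\<^sup>2)) \<longlongrightarrow> 0) at_top" using g by real_asymp
    show "((\<lambda>L::real. L / ln L * (L * ((d ^ 4 + 6 * (g * L - d) * d\<^sup>2 - 8 * (g * L - d) * d
          + 3 * (g * L - d)\<^sup>2 + 6 * (g * L - d)) / L ^ 4))) \<longlongrightarrow> 0) at_top" using g by real_asymp
    show "((\<lambda>L::real. L / ln L * (L * exp (- p * (L / (1 - \<eta>))))) \<longlongrightarrow> 0) at_top"
      using p \<eta> by real_asymp
  qed
  then have "(\<lambda>j. err (L j)) \<longlonglongrightarrow> 0"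
    using filterlim_compose[OF _ L_top, of err "nhds 0"] by simp
  from order_tendstoD(2)[OF this, of "\<epsilon> / 2"] have "\<forall>\<^sub>F j in sequentially. err (L j) < \<epsilon> / 2"
    using \<epsilon> by simp
  moreover have "\<forall>\<^sub>F j in sequentially. L j \<ge> L0"
    using L_top by (simp add: filterlim_at_top)
  ultimately show "\<forall>\<^sub>F j in sequentially.
      dist (((real n * L j / \<alpha>) powr expo * ctilde c j (real j / \<eta>) - 1) * (L j / ln (L j))) ((real n - 1) * expo) < \<epsilon>"
    using eventually_ge_at_top[of n]
  proof eventually_elim
    case (elim j)
    define T where "T = real j / \<eta>"
    define l where "l = L j"
    define I where "I = ctilde c j T - initial_part j T"
    have l: "l > exp 1" "l \<ge> L0" using elim L0 by (auto simp: l_def)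
    have l0: "l > 0" "l > 1" using l(1) by (meson exp_gt_zero less_trans one_less_exp_iff zero_less_one)+
    have ln: "ln l > 0" using l0 by simp
    have T: "T \<ge> 0" "T = l + real j" "T = l / (1 - \<eta>)" using \<eta> jL(2)[of j] by (auto simp: T_def l_def L_def)
    have shift: "T - s - l = real j - s" for s using T(2) by simp
    have k: "real (j - n + 1) = g * l - d" using jL(1)[of j] elim(3) by (simp add: l_def d_def of_nat_diff)
    have "\<bar>B * l powr expo * I - (1 - expo * d / l + \<kappa> * (ln l / l))\<bar>
      \<le> \<epsilon> / 2 * (ln l / l) + 2 * ((d\<^sup>2 + (g * l - d)) / l\<^sup>2)
        + C * l * ((d ^ 4 + 6 * (g * l - d) * d\<^sup>2 - 8 * (g * l - d) * d + 3 * (g * l - d)\<^sup>2 + 6 * (g * l - d)) / l ^ 4)"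
    proof (rule erlang_average_of_decaying_input[where x = "real j" and m = "j - n" and T = T and u = creation_rate])
      show "\<bar>B * l powr expo * creation_rate (T - s) - (1 - expo * ((real j - s) / l) + \<kappa> * (ln l / l))\<bar>
        \<le> \<epsilon> / 2 * (ln l / l) + 2 * ((real j - s) / l)\<^sup>2 + C * l * ((real j - s) / l) ^ 4" for s
        using tangent[OF l(2), of "T - s"] unfolding shift .
      show "((\<lambda>s. erlang (j - n) s * creation_rate (T - s)) has_integral I) {0..T}"
        unfolding I_def by (rule ctilde_representation[OF T(1) elim(3)])
      show "d = real j - real (j - n + 1)" using elim(3) by (simp add: d_def of_nat_diff)
      show "g * l - d = real (j - n + 1)" by (rule k[symmetric])
    qed (simp add: creation_rate_def)
    moreover have "0 \<le> B * l powr expo * initial_part j T"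
      using initial_part_nonneg[OF T(1) elim(3)] B by simp
    moreover have "B * l powr expo * initial_part j T \<le> B * l * (\<rho> * exp (- p * (l / (1 - \<eta>))))"
    proof (rule mult_mono)
      have "l powr expo \<le> l powr 1" using expo_bounds l0 by (intro powr_mono) auto
      then show "B * l powr expo \<le> B * l" using B l0 by (intro mult_left_mono) auto
      show "initial_part j T \<le> \<rho> * exp (- p * (l / (1 - \<eta>)))"
        using initial_part_behind_front[OF \<eta> elim(3)] unfolding p_def T(3)[symmetric] T_def .
    qed (use B l0 initial_part_nonneg[OF T(1) elim(3)] in auto)
    moreover have "B * l powr expo * ctilde c j T = B * l powr expo * I + B * l powr expo * initial_part j T"
      by (simp add: I_def algebra_simps)
    moreover have "expo * d / l \<ge> 0"
      using expo_bounds l0 n_ge_2 by (simp add: d_def)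
    ultimately have "\<bar>B * l powr expo * ctilde c j T - 1 - \<kappa> * (ln l / l)\<bar>
      \<le> \<epsilon> / 2 * (ln l / l) + (expo * d / l + 2 * ((d\<^sup>2 + (g * l - d)) / l\<^sup>2)
        + C * l * ((d ^ 4 + 6 * (g * l - d) * d\<^sup>2 - 8 * (g * l - d) * d + 3 * (g * l - d)\<^sup>2 + 6 * (g * l - d)) / l ^ 4)
        + B * l * (\<rho> * exp (- p * (l / (1 - \<eta>)))))"
      by linarith
    then have "\<bar>B * l powr expo * ctilde c j T - 1 - \<kappa> * (ln l / l)\<bar> * (l / ln l)
      \<le> (\<epsilon> / 2 * (ln l / l) + (expo * d / l + 2 * ((d\<^sup>2 + (g * l - d)) / l\<^sup>2)
        + C * l * ((d ^ 4 + 6 * (g * l - d) * d\<^sup>2 - 8 * (g * l - d) * d + 3 * (g * l - d)\<^sup>2 + 6 * (g * l - d)) / l ^ 4)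
        + B * l * (\<rho> * exp (- p * (l / (1 - \<eta>)))))) * (l / ln l)"
      using l0 ln by (intro mult_right_mono) auto
    also have "\<dots> = \<epsilon> / 2 * (ln l / l * (l / ln l)) + err l"
      unfolding err_def by (simp add: algebra_simps)
    also have "ln l / l * (l / ln l) = 1" using l0 ln by simp
    also have "\<epsilon> / 2 * 1 + err l < \<epsilon>" using elim(1) by (simp add: l_def)
    also have "\<bar>B * l powr expo * ctilde c j T - 1 - \<kappa> * (ln l / l)\<bar> * (l / ln l)
      = \<bar>(B * l powr expo * ctilde c j T - 1 - \<kappa> * (ln l / l)) * (l / ln l)\<bar>"
      using l0 ln by (simp add: abs_mult)
    also have "(B * l powr expo * ctilde c j T - 1 - \<kappa> * (ln l / l)) * (l / ln l)
      = (B * l powr expo * ctilde c j T - 1) * (l / ln l) - \<kappa> * (ln l / l * (l / ln l))"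
      by (simp only: left_diff_distrib mult.assoc)
    also have "ln l / l * (l / ln l) = 1" using l0 ln by simp
    also have "B * l powr expo = (real n * l / \<alpha>) powr expo"
      using l0 \<alpha>_pos by (simp add: B_def powr_mult powr_divide)
    finally show ?case by (simp add: dist_real_def \<kappa>_def l_def T_def)
  qed
qed

end

theorem theorem2:
  fixes n :: nat and \<alpha> \<rho>\<^sub>1 \<rho>\<^sub>2 \<mu> \<eta> :: real and c :: "nat \<Rightarrow> real \<Rightarrow> real"
  assumes "n \<ge> 2" and "\<alpha> > 0"
    and "nonneg_solution n \<alpha> c"
    and "\<rho>\<^sub>1 > 0" and "\<rho>\<^sub>2 > 0" and "\<mu> > 1"
    and "\<forall>j\<ge>n. real j powr \<mu> * c j 0 \<in> {\<rho>\<^sub>1..\<rho>\<^sub>2}"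
    and "\<eta> \<in> {0<..} - {1}"
  shows "\<exists>K :: nat \<Rightarrow> real. K \<in> O(\<lambda>_. 1) \<and>
    (\<lambda>j. let \<tau> = real j / \<eta> in
       \<bar>(real n * \<tau> / \<alpha>) powr ((real n - 1) / real n) * ctilde c j \<tau> - Phi1 n \<eta>\<bar>)
    \<sim>[sequentially]
    (\<lambda>j. let \<tau> = real j / \<eta> in
       (real n - 1) * (1 - 1 / real n) * (1 - \<eta>) powr (- (real n - 1) / real n)
         * (ln ((1 - \<eta>) * \<tau>) / ((1 - \<eta>) * \<tau>)) * indicator {0<..<1} \<eta>
       + (real n / \<alpha>) powr ((real n - 1) / real n) * K j
         * \<eta> powr (- \<mu>) * \<tau> powr ((real n - 1) / real n - \<mu>) * indicator {1<..} \<eta>)"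
proof -
  interpret decaying_initial_data n \<alpha> c \<rho>\<^sub>2 \<mu>
  proof
    fix j assume j: "j \<ge> n"
    then have "real j powr \<mu> * c j 0 \<le> \<rho>\<^sub>2" using assms(7) by auto
    moreover have "real j powr \<mu> > 0" using j assms(1) by simp
    ultimately show "c j 0 \<le> \<rho>\<^sub>2 * real j powr (- \<mu>)"
      by (simp add: powr_minus field_simps)
  qed (use assms in auto)
  have expo: "(real n - 1) / real n = expo" "- (real n - 1) / real n = - expo" "1 - 1 / real n = expo"
    using assms(1) by (auto simp: expo_def field_simps)
  consider "0 < \<eta>" "\<eta> < 1" | "\<eta> > 1" using assms(8) by force
  then show ?thesis
  proof cases
    case 1
    define L where "L = (\<lambda>j. real j / \<eta> - real j)"
    define \<kappa> where "\<kappa> = (real n - 1) * expo"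
    define G where "G = (\<lambda>j. (real n * L j / \<alpha>) powr expo * ctilde c j (real j / \<eta>) - 1)"
    have \<kappa>: "\<kappa> > 0" using expo_bounds assms(1) by (simp add: \<kappa>_def)
    have L: "(1 - \<eta>) * (real j / \<eta>) = L j" for j using 1 by (simp add: L_def field_simps)
    have lim: "(\<lambda>j. G j * (L j / ln (L j))) \<longlonglongrightarrow> \<kappa>"
      unfolding G_def \<kappa>_def L_def by (rule ctilde_behind_front[OF 1])
    have equiv: "(\<lambda>j. (1 - \<eta>) powr (- expo) * \<bar>G j\<bar>) \<sim>[sequentially]
        (\<lambda>j. \<kappa> * (1 - \<eta>) powr (- expo) * (ln (L j) / L j))"
    proof (rule asymp_equivI')
      have "(\<lambda>j. \<bar>G j * (L j / ln (L j))\<bar> / \<kappa>) \<longlonglongrightarrow> \<bar>\<kappa>\<bar> / \<kappa>"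
        using \<kappa> by (intro tendsto_intros lim) auto
      then have "(\<lambda>j. \<bar>G j * (L j / ln (L j))\<bar> / \<kappa>) \<longlonglongrightarrow> 1" using \<kappa> by simp
      then show "(\<lambda>j. (1 - \<eta>) powr (- expo) * \<bar>G j\<bar> / (\<kappa> * (1 - \<eta>) powr (- expo) * (ln (L j) / L j)))
          \<longlonglongrightarrow> 1"
      proof (rule Lim_transform_eventually)
        have "filterlim (\<lambda>j. (1 / \<eta> - 1) * real j) at_top sequentially"
          using 1 by (intro filterlim_tendsto_pos_mult_at_top[OF tendsto_const] filterlim_real_sequentially) auto
        then have "filterlim L at_top sequentially" by (simp add: L_def algebra_simps)
        then have "\<forall>\<^sub>F j in sequentially. L j > 1" by (simp add: filterlim_at_top_dense)
        then show "\<forall>\<^sub>F j in sequentially. \<bar>G j * (L j / ln (L j))\<bar> / \<kappa>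
            = (1 - \<eta>) powr (- expo) * \<bar>G j\<bar> / (\<kappa> * (1 - \<eta>) powr (- expo) * (ln (L j) / L j))"
        proof eventually_elim
          case (elim j)
          then have "ln (L j) > 0" by simp
          then show ?case using elim 1 \<kappa> by (simp add: abs_mult field_simps)
        qed
      qed
    qed
    have lhs: "\<bar>(real n * (real j / \<eta>) / \<alpha>) powr expo * ctilde c j (real j / \<eta>) - Phi1 n \<eta>\<bar>
        = (1 - \<eta>) powr (- expo) * \<bar>G j\<bar>" for j
    proof -
      have "(real n * L j / \<alpha>) powr expo = (1 - \<eta>) powr expo * (real n * (real j / \<eta>) / \<alpha>) powr expo"
      proof -
        have "real n * L j / \<alpha> = (1 - \<eta>) * (real n * (real j / \<eta>) / \<alpha>)"
          by (simp flip: L add: mult_ac)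
        then show ?thesis by (simp only: powr_mult)
      qed
      moreover have "Phi1 n \<eta> = (1 - \<eta>) powr (- expo)"
        unfolding Phi1_def expo using 1 by simp
      ultimately have "(1 - \<eta>) powr (- expo) * G j
          = (real n * (real j / \<eta>) / \<alpha>) powr expo * ctilde c j (real j / \<eta>) - Phi1 n \<eta>"
        using 1 by (simp add: G_def powr_minus field_simps)
      then have "\<bar>(1 - \<eta>) powr (- expo) * G j\<bar>
          = \<bar>(real n * (real j / \<eta>) / \<alpha>) powr expo * ctilde c j (real j / \<eta>) - Phi1 n \<eta>\<bar>" by simp
      then show ?thesis by (simp add: abs_mult)
    qed
    have rhs: "(real n - 1) * expo * (1 - \<eta>) powr (- expo) * (ln (L j) / L j) * indicator {0<..<1} \<eta>
        + (real n / \<alpha>) powr expo * 0 * \<eta> powr (- \<mu>) * (real j / \<eta>) powr (expo - \<mu>) * indicator {1<..} \<eta>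
      = \<kappa> * (1 - \<eta>) powr (- expo) * (ln (L j) / L j)" for j
      using 1 by (simp add: \<kappa>_def)
    show ?thesis
      by (rule exI[of _ "\<lambda>_. 0"]) (use equiv in \<open>simp only: Let_def expo L lhs rhs, simp\<close>)
  next
    case 2
    \<comment> \<open>With this \<open>K\<close> both sides are equal for \<open>j \<ge> n\<close>; the content is that \<open>K\<close> is bounded.\<close>
    define K where "K = (\<lambda>j. real j powr \<mu> * ctilde c j (real j / \<eta>))"
    have "K \<in> O(\<lambda>_. 1)" unfolding K_def by (rule ctilde_ahead_of_front[OF 2])
    moreover have "(\<lambda>j. \<bar>(real n * (real j / \<eta>) / \<alpha>) powr expo * ctilde c j (real j / \<eta>) - Phi1 n \<eta>\<bar>)
      \<sim>[sequentially] (\<lambda>j. (real n / \<alpha>) powr expo * K j * \<eta> powr (- \<mu>) * (real j / \<eta>) powr (expo - \<mu>))"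
    proof (rule asymp_equiv_refl_ev)
      show "\<forall>\<^sub>F j in sequentially. \<bar>(real n * (real j / \<eta>) / \<alpha>) powr expo * ctilde c j (real j / \<eta>) - Phi1 n \<eta>\<bar>
        = (real n / \<alpha>) powr expo * K j * \<eta> powr (- \<mu>) * (real j / \<eta>) powr (expo - \<mu>)"
        using eventually_ge_at_top[of n]
      proof eventually_elim
        case (elim j)
        define T where "T = real j / \<eta>"
        have T: "T > 0" "real j = \<eta> * T" using elim assms(1) 2 by (auto simp: T_def)
        have "ctilde c j T \<ge> 0" using T elim by (intro ctilde_nonneg) auto
        then have "\<bar>(real n * T / \<alpha>) powr expo * ctilde c j T - Phi1 n \<eta>\<bar> = (real n * T / \<alpha>) powr expo * ctilde c j T"
          using 2 by (simp add: Phi1_def)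
        also have "\<dots> = (real n / \<alpha>) powr expo * T powr expo * ctilde c j T"
          using T assms(2) by (simp add: powr_mult powr_divide)
        also have "\<dots> = (real n / \<alpha>) powr expo * (real j powr \<mu> * ctilde c j T) * \<eta> powr (- \<mu>) * T powr (expo - \<mu>)"
          using T(1) 2 unfolding T(2) by (simp add: powr_mult powr_minus powr_diff field_simps)
        finally show ?case by (simp add: T_def K_def)
      qed
    qed
    ultimately show ?thesis
      using 2 by (intro exI[of _ K]) (simp add: Let_def expo)
  qed
qed

end
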